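(* Let $F:(M,\phi,\xi,\eta,g)\to (N,g')$ be a bi-slant submersion from a Sasakian manifold onto a Riemannian manifold, with bi-slant angles $\theta_1,\theta_2$ and $\ker F_*=D_1\oplus D_2$. Then the distribution $D_2$ defines a totally geodesic foliation if and only if both $$-g(\mathcal{T}_W\omega\varphi Z,U)=g(\mathcal{T}_W\omega Z,\varphi U)+g(\mathcal{H}\nabla_W\omega Z,\omega U)$$ and $$g(\mathcal{T}_W\omega Z,BX)=g(\mathcal{H}\nabla_W\omega\varphi Z,X)-g(\mathcal{H}\nabla_W\omega Z,CX)$$ hold for all $U\in\Gamma(D_1)$, $W,Z\in\Gamma(D_2)$ and $X\in\Gamma((\ker F_* )^\perp)$.
   Context: An almost contact metric manifold $(M,\phi,\xi,\eta,g)$ satisfies $\phi^2=-I+\eta\otimes\xi$, $\eta(\xi)=1$, $\eta\circ\phi=0$, $\phi\xi=0$, $g(\phi X,\phi Y)=g(X,Y)-\eta(X)\eta(Y)$. It is Sasakian (normal contact metric) with structure equations $(\nabla_X\phi)Y=g(X,Y)\xi-\eta(Y)X$ and $\nabla_X\xi=-\phi X$, where $\nabla$ is the Levi-Civita connection of $g$. A Riemannian submersion $F:(M,g)\to(N,g')$ with $\dim M>\dim N$ is a surjective map of maximal rank whose differential $F_*$ preserves lengths of horizontal vectors; $\ker F_*$ is the vertical distribution, $(\ker F_* )^\perp$ the horizontal one, with orthogonal projections $\mathcal{V}$ and $\mathcal{H}$. The O'Neill tensor $\mathcal{T}$ is $\mathcal{T}_EG=\mathcal{H}\nabla_{\mathcal{V}E}\mathcal{V}G+\mathcal{V}\nabla_{\mathcal{V}E}\mathcal{H}G$.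 Bi-slant submersion ($\xi$ horizontal): a Riemannian submersion $F$ from a Sasakian manifold with $\xi\in\Gamma((\ker F_* )^\perp)$ and an orthogonal decomposition $\ker F_*=D_1\oplus D_2$ into distributions such that for each $i=1,2$, the angle between $\phi X$ and $(D_i)_p$ equals the same constant $\theta_i$ for every $p\in M$ and every nonzero $X\in(D_i)_p$; and $\phi D_1\perp D_2$, $\phi D_2\perp D_1$. The numbers $\theta_1,\theta_2$ are the bi-slant angles. Notation: for vertical $U$, $\phi U=\varphi U+\omega U$ with $\varphi U$ vertical, $\omega U$ horizontal. For horizontal $X$, $\phi X=BX+CX$ with $BX$ vertical, $CX$ horizontal. A distribution $D$ defines a totally geodesic foliation if $\nabla_UV\in\Gamma(D)$ for all $U,V\in\Gamma(D)$. *)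

theory Defs
  imports "HOL-Analysis.Analysis"
begin

subsection \<open>Smooth functions on open subsets of Euclidean spaces\<close>

text \<open>\<open>S\<close> is meant to be open: a function is \<open>k + 1\<close> times continuously differentiable if it is
  differentiable and all its directional derivatives are \<open>k\<close> times continuously differentiable.\<close>

primrec Ck_on :: "nat \<Rightarrow> 'e::euclidean_space set \<Rightarrow> ('e \<Rightarrow> 'f::euclidean_space) \<Rightarrow> bool" where
  "Ck_on 0 S f \<longleftrightarrow> continuous_on S f"
| "Ck_on (Suc k) S f \<longleftrightarrow>
     f differentiable_on S \<and> (\<forall>v. Ck_on k S (\<lambda>x. frechet_derivative f (at x) v))"

definition smooth_on :: "'e::euclidean_space set \<Rightarrow> ('e \<Rightarrow> 'f::euclidean_space) \<Rightarrow> bool" where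
  "smooth_on S f \<longleftrightarrow> (\<forall>k. Ck_on k S f)"


subsection \<open>Smooth manifolds\<close>

text \<open>The underlying topological space of a manifold is a (Hausdorff, second countable) type \<open>'a\<close>;
  the smooth structure, of dimension \<open>DIM('e)\<close>, is given by an atlas. A chart is a pair of
  its domain and its coordinate map (whose values outside the domain are irrelevant).\<close>

type_synonym ('a, 'e) chart = "'a set \<times> ('a \<Rightarrow> 'e)"

definition chart_inv :: "('a, 'e) chart \<Rightarrow> 'e \<Rightarrow> 'a" where
  "chart_inv c = inv_into (fst c) (snd c)"

definition is_chart :: "('a::topological_space, 'e::euclidean_space) chart \<Rightarrow> bool" where
  "is_chart c \<longleftrightarrow> open (fst c) \<and> open (snd c ` fst c) \<and>
     homeomorphism (fst c) (snd c ` fst c) (snd c) (chart_inv c)"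

definition smooth_atlas ::
  "('a::{t2_space, second_countable_topology}, 'e::euclidean_space) chart set \<Rightarrow> bool" where
  "smooth_atlas A \<longleftrightarrow> (\<forall>c\<in>A. is_chart c) \<and> (\<Union>c\<in>A. fst c) = UNIV \<and>
     (\<forall>c\<in>A. \<forall>d\<in>A. smooth_on (snd c ` (fst c \<inter> fst d)) (snd d \<circ> chart_inv c))"

definition smooth_fun ::
  "('a::topological_space, 'e::euclidean_space) chart set \<Rightarrow> ('a \<Rightarrow> real) \<Rightarrow> bool" where
  "smooth_fun A f \<longleftrightarrow> (\<forall>c\<in>A. smooth_on (snd c ` fst c) (f \<circ> chart_inv c))"

definition smooth_map ::
  "('a::topological_space, 'e::euclidean_space) chart set \<Rightarrow>
   ('b::topological_space, 'f::euclidean_space) chart set \<Rightarrow> ('a \<Rightarrow> 'b) \<Rightarrow> bool" where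
  "smooth_map A B F \<longleftrightarrow> continuous_on UNIV F \<and>
     (\<forall>c\<in>A. \<forall>d\<in>B. smooth_on (snd c ` (fst c \<inter> F -` fst d)) (snd d \<circ> F \<circ> chart_inv c))"


subsection \<open>Tangent vectors and vector fields\<close>

text \<open>A tangent vector at \<open>p\<close> is represented by its components, an element of \<open>'e\<close>, with respect to
  a chart \<open>chart_at A p\<close> around \<open>p\<close> that is chosen once and for all. Its components in any other
  chart are obtained by applying the derivative of the coordinate change. A vector field is thus
  a function \<open>'a \<Rightarrow> 'e\<close>, but its smoothness has to be read off from its components in a fixed chart,
  not from this function (\<open>chart_at A p\<close> may jump with \<open>p\<close>).\<close>

definition chart_at :: "('a, 'e) chart set \<Rightarrow> 'a \<Rightarrow> ('a, 'e) chart" where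
  "chart_at A p = (SOME c. c \<in> A \<and> p \<in> fst c)"

definition components ::
  "('a, 'e::euclidean_space) chart set \<Rightarrow> ('a, 'e) chart \<Rightarrow> 'a \<Rightarrow> 'e \<Rightarrow> 'e" where
  "components A c p v =
     frechet_derivative (snd c \<circ> chart_inv (chart_at A p)) (at (snd (chart_at A p) p)) v"

definition smooth_field_on ::
  "('a::topological_space, 'e::euclidean_space) chart set \<Rightarrow> 'a set \<Rightarrow> ('a \<Rightarrow> 'e) \<Rightarrow> bool" where
  "smooth_field_on A S X \<longleftrightarrow> (\<forall>c\<in>A. smooth_on (snd c ` (fst c \<inter> S))
     (\<lambda>z. components A c (chart_inv c z) (X (chart_inv c z))))"

abbreviation smooth_field ::
  "('a::topological_space, 'e::euclidean_space) chart set \<Rightarrow> ('a \<Rightarrow> 'e) \<Rightarrow> bool" where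
  "smooth_field A \<equiv> smooth_field_on A UNIV"

definition deriv_along ::
  "('a, 'e::euclidean_space) chart set \<Rightarrow> ('a \<Rightarrow> 'e) \<Rightarrow> ('a \<Rightarrow> real) \<Rightarrow> 'a \<Rightarrow> real" where
  "deriv_along A X f p =
     frechet_derivative (f \<circ> chart_inv (chart_at A p)) (at (snd (chart_at A p) p)) (X p)"

definition differential ::
  "('a, 'e::euclidean_space) chart set \<Rightarrow> ('b, 'f::euclidean_space) chart set \<Rightarrow>
   ('a \<Rightarrow> 'b) \<Rightarrow> 'a \<Rightarrow> 'e \<Rightarrow> 'f" where
  "differential A B F p =
     frechet_derivative (snd (chart_at B (F p)) \<circ> F \<circ> chart_inv (chart_at A p))
       (at (snd (chart_at A p) p))"

text \<open>\<open>L = [X, Y]\<close>, the Lie bracket being the vector field that acts on functions as the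
  commutator of \<open>X\<close> and \<open>Y\<close>.\<close>

definition is_lie_bracket ::
  "('a::topological_space, 'e::euclidean_space) chart set \<Rightarrow>
   ('a \<Rightarrow> 'e) \<Rightarrow> ('a \<Rightarrow> 'e) \<Rightarrow> ('a \<Rightarrow> 'e) \<Rightarrow> bool" where
  "is_lie_bracket A X Y L \<longleftrightarrow> smooth_field A L \<and>
     (\<forall>f. smooth_fun A f \<longrightarrow> (\<forall>p. deriv_along A L f p =
        deriv_along A X (deriv_along A Y f) p - deriv_along A Y (deriv_along A X f) p))"


subsection \<open>Distributions\<close>

definition distribution ::
  "('a::topological_space, 'e::euclidean_space) chart set \<Rightarrow> ('a \<Rightarrow> 'e set) \<Rightarrow> bool" where
  "distribution A D \<longleftrightarrow> (\<exists>k::nat. \<forall>p. \<exists>S X. open S \<and> p \<in> S \<and>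
     (\<forall>i<k. smooth_field_on A S (X i)) \<and>
     (\<forall>q\<in>S. inj_on (\<lambda>i. X i q) {..<k} \<and> independent ((\<lambda>i. X i q) ` {..<k}) \<and>
        span ((\<lambda>i. X i q) ` {..<k}) = D q))"

definition sections ::
  "('a::topological_space, 'e::euclidean_space) chart set \<Rightarrow> ('a \<Rightarrow> 'e set) \<Rightarrow> ('a \<Rightarrow> 'e) set" where
  "sections A D = {X. smooth_field A X \<and> (\<forall>p. X p \<in> D p)}"


subsection \<open>Riemannian metrics and the Levi-Civita connection\<close>

definition riemannian_metric ::
  "('a::topological_space, 'e::euclidean_space) chart set \<Rightarrow> ('a \<Rightarrow> 'e \<Rightarrow> 'e \<Rightarrow> real) \<Rightarrow> bool" where
  "riemannian_metric A g \<longleftrightarrow>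
     (\<forall>p. bilinear (g p) \<and> (\<forall>u v. g p u v = g p v u) \<and> (\<forall>v. v \<noteq> 0 \<longrightarrow> g p v v > 0)) \<and>
     (\<forall>X Y. smooth_field A X \<longrightarrow> smooth_field A Y \<longrightarrow> smooth_fun A (\<lambda>p. g p (X p) (Y p)))"

definition levi_civita ::
  "('a::topological_space, 'e::euclidean_space) chart set \<Rightarrow> ('a \<Rightarrow> 'e \<Rightarrow> 'e \<Rightarrow> real) \<Rightarrow>
   (('a \<Rightarrow> 'e) \<Rightarrow> ('a \<Rightarrow> 'e) \<Rightarrow> ('a \<Rightarrow> 'e)) \<Rightarrow> bool" where
  "levi_civita A g nabla \<longleftrightarrow>
     (\<forall>X Y. smooth_field A X \<longrightarrow> smooth_field A Y \<longrightarrow> smooth_field A (nabla X Y)) \<and>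
     (\<forall>X X' Y. smooth_field A X \<longrightarrow> smooth_field A X' \<longrightarrow> smooth_field A Y \<longrightarrow>
        nabla (\<lambda>p. X p + X' p) Y = (\<lambda>p. nabla X Y p + nabla X' Y p)) \<and>
     (\<forall>f X Y. smooth_fun A f \<longrightarrow> smooth_field A X \<longrightarrow> smooth_field A Y \<longrightarrow>
        nabla (\<lambda>p. f p *\<^sub>R X p) Y = (\<lambda>p. f p *\<^sub>R nabla X Y p)) \<and>
     (\<forall>X Y Y'. smooth_field A X \<longrightarrow> smooth_field A Y \<longrightarrow> smooth_field A Y' \<longrightarrow>
        nabla X (\<lambda>p. Y p + Y' p) = (\<lambda>p. nabla X Y p + nabla X Y' p)) \<and>
     (\<forall>f X Y. smooth_fun A f \<longrightarrow> smooth_field A X \<longrightarrow> smooth_field A Y \<longrightarrow>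
        nabla X (\<lambda>p. f p *\<^sub>R Y p) =
          (\<lambda>p. deriv_along A X f p *\<^sub>R Y p + f p *\<^sub>R nabla X Y p)) \<and>
     (\<forall>X Y. smooth_field A X \<longrightarrow> smooth_field A Y \<longrightarrow>
        is_lie_bracket A X Y (\<lambda>p. nabla X Y p - nabla Y X p)) \<and>
     (\<forall>X Y Z. smooth_field A X \<longrightarrow> smooth_field A Y \<longrightarrow> smooth_field A Z \<longrightarrow>
        (\<forall>p. deriv_along A X (\<lambda>q. g q (Y q) (Z q)) p =
           g p (nabla X Y p) (Z p) + g p (Y p) (nabla X Z p)))"

definition totally_geodesic_foliation ::
  "('a::topological_space, 'e::euclidean_space) chart set \<Rightarrow>
   (('a \<Rightarrow> 'e) \<Rightarrow> ('a \<Rightarrow> 'e) \<Rightarrow> ('a \<Rightarrow> 'e)) \<Rightarrow> ('a \<Rightarrow> 'e set) \<Rightarrow> bool" where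
  "totally_geodesic_foliation A nabla D \<longleftrightarrow>
     (\<forall>U\<in>sections A D. \<forall>V\<in>sections A D. nabla U V \<in> sections A D)"

text \<open>Linear algebra in one tangent space, with inner product \<open>b\<close>.\<close>

definition vlength :: "('e \<Rightarrow> 'e \<Rightarrow> real) \<Rightarrow> 'e \<Rightarrow> real" where
  "vlength b v = sqrt (b v v)"

definition orth_proj :: "('e::euclidean_space \<Rightarrow> 'e \<Rightarrow> real) \<Rightarrow> 'e set \<Rightarrow> 'e \<Rightarrow> 'e" where
  "orth_proj b S v = (THE u. u \<in> S \<and> (\<forall>w\<in>S. b (v - u) w = 0))"

definition subspace_angle :: "('e::euclidean_space \<Rightarrow> 'e \<Rightarrow> real) \<Rightarrow> 'e \<Rightarrow> 'e set \<Rightarrow> real" where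
  "subspace_angle b v S = arccos (vlength b (orth_proj b S v) / vlength b v)"


subsection \<open>Sasakian manifolds\<close>

definition almost_contact_metric ::
  "('a::topological_space, 'e::euclidean_space) chart set \<Rightarrow> ('a \<Rightarrow> 'e \<Rightarrow> 'e) \<Rightarrow> ('a \<Rightarrow> 'e) \<Rightarrow>
   ('a \<Rightarrow> 'e \<Rightarrow> real) \<Rightarrow> ('a \<Rightarrow> 'e \<Rightarrow> 'e \<Rightarrow> real) \<Rightarrow> bool" where
  "almost_contact_metric A phi xi eta g \<longleftrightarrow>
     riemannian_metric A g \<and>
     (\<forall>p. linear (phi p)) \<and>
     (\<forall>X. smooth_field A X \<longrightarrow> smooth_field A (\<lambda>p. phi p (X p))) \<and>
     smooth_field A xi \<and>
     (\<forall>p. linear (eta p)) \<and>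
     (\<forall>X. smooth_field A X \<longrightarrow> smooth_fun A (\<lambda>p. eta p (X p))) \<and>
     (\<forall>p v. phi p (phi p v) = - v + eta p v *\<^sub>R xi p) \<and>
     (\<forall>p. eta p (xi p) = 1) \<and>
     (\<forall>p v. eta p (phi p v) = 0) \<and>
     (\<forall>p. phi p (xi p) = 0) \<and>
     (\<forall>p u v. g p (phi p u) (phi p v) = g p u v - eta p u * eta p v)"

text \<open>\<open>d\<eta>(X, Y) = g(X, \<phi>Y)\<close>, with the convention
  \<open>2 d\<eta>(X, Y) = X \<eta>(Y) - Y \<eta>(X) - \<eta>([X, Y])\<close>.\<close>

definition contact_metric ::
  "('a::topological_space, 'e::euclidean_space) chart set \<Rightarrow> ('a \<Rightarrow> 'e \<Rightarrow> 'e) \<Rightarrow>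
   ('a \<Rightarrow> 'e \<Rightarrow> real) \<Rightarrow> ('a \<Rightarrow> 'e \<Rightarrow> 'e \<Rightarrow> real) \<Rightarrow> bool" where
  "contact_metric A phi eta g \<longleftrightarrow>
     (\<forall>X Y L. smooth_field A X \<longrightarrow> smooth_field A Y \<longrightarrow> is_lie_bracket A X Y L \<longrightarrow>
        (\<forall>p. (deriv_along A X (\<lambda>q. eta q (Y q)) p - deriv_along A Y (\<lambda>q. eta q (X q)) p
               - eta p (L p)) / 2 = g p (X p) (phi p (Y p))))"

text \<open>\<open>[\<phi>, \<phi>](X, Y) + 2 d\<eta>(X, Y) \<xi> = 0\<close>, where
  \<open>[\<phi>, \<phi>](X, Y) = \<phi>\<phi>[X, Y] + [\<phi>X, \<phi>Y] - \<phi>[\<phi>X, Y] - \<phi>[X, \<phi>Y]\<close> is the Nijenhuis torsion.\<close>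

definition normal_structure ::
  "('a::topological_space, 'e::euclidean_space) chart set \<Rightarrow> ('a \<Rightarrow> 'e \<Rightarrow> 'e) \<Rightarrow> ('a \<Rightarrow> 'e) \<Rightarrow>
   ('a \<Rightarrow> 'e \<Rightarrow> real) \<Rightarrow> bool" where
  "normal_structure A phi xi eta \<longleftrightarrow>
     (\<forall>X Y L1 L2 L3 L4. smooth_field A X \<longrightarrow> smooth_field A Y \<longrightarrow>
        is_lie_bracket A X Y L1 \<longrightarrow>
        is_lie_bracket A (\<lambda>p. phi p (X p)) (\<lambda>p. phi p (Y p)) L2 \<longrightarrow>
        is_lie_bracket A (\<lambda>p. phi p (X p)) Y L3 \<longrightarrow>
        is_lie_bracket A X (\<lambda>p. phi p (Y p)) L4 \<longrightarrow>
        (\<forall>p. phi p (phi p (L1 p)) + L2 p - phi p (L3 p) - phi p (L4 p)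
           + (deriv_along A X (\<lambda>q. eta q (Y q)) p - deriv_along A Y (\<lambda>q. eta q (X q)) p
               - eta p (L1 p)) *\<^sub>R xi p = 0))"

text \<open>The two structure equations at the end are in fact equivalent to the structure being contact
  metric and normal; \<open>nabla\<close> is meant to be the Levi-Civita connection of \<open>g\<close>.\<close>

definition sasakian ::
  "('a::topological_space, 'e::euclidean_space) chart set \<Rightarrow> ('a \<Rightarrow> 'e \<Rightarrow> 'e) \<Rightarrow> ('a \<Rightarrow> 'e) \<Rightarrow>
   ('a \<Rightarrow> 'e \<Rightarrow> real) \<Rightarrow> ('a \<Rightarrow> 'e \<Rightarrow> 'e \<Rightarrow> real) \<Rightarrow>
   (('a \<Rightarrow> 'e) \<Rightarrow> ('a \<Rightarrow> 'e) \<Rightarrow> ('a \<Rightarrow> 'e)) \<Rightarrow> bool" where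
  "sasakian A phi xi eta g nabla \<longleftrightarrow>
     almost_contact_metric A phi xi eta g \<and>
     contact_metric A phi eta g \<and>
     normal_structure A phi xi eta \<and>
     (\<forall>X Y. smooth_field A X \<longrightarrow> smooth_field A Y \<longrightarrow>
        (\<forall>p. nabla X (\<lambda>q. phi q (Y q)) p - phi p (nabla X Y p) =
           g p (X p) (Y p) *\<^sub>R xi p - eta p (Y p) *\<^sub>R X p)) \<and>
     (\<forall>X. smooth_field A X \<longrightarrow> (\<forall>p. nabla X xi p = - phi p (X p)))"


subsection \<open>Riemannian submersions\<close>

definition vert ::
  "('a, 'e::euclidean_space) chart set \<Rightarrow> ('b, 'f::euclidean_space) chart set \<Rightarrow>
   ('a \<Rightarrow> 'b) \<Rightarrow> 'a \<Rightarrow> 'e set" where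
  "vert A B F p = {v. differential A B F p v = 0}"

definition horiz ::
  "('a, 'e::euclidean_space) chart set \<Rightarrow> ('b, 'f::euclidean_space) chart set \<Rightarrow>
   ('a \<Rightarrow> 'e \<Rightarrow> 'e \<Rightarrow> real) \<Rightarrow> ('a \<Rightarrow> 'b) \<Rightarrow> 'a \<Rightarrow> 'e set" where
  "horiz A B g F p = {v. \<forall>u\<in>vert A B F p. g p v u = 0}"

definition riemannian_submersion ::
  "('a::topological_space, 'e::euclidean_space) chart set \<Rightarrow> ('a \<Rightarrow> 'e \<Rightarrow> 'e \<Rightarrow> real) \<Rightarrow>
   ('b::topological_space, 'f::euclidean_space) chart set \<Rightarrow> ('b \<Rightarrow> 'f \<Rightarrow> 'f \<Rightarrow> real) \<Rightarrow>
   ('a \<Rightarrow> 'b) \<Rightarrow> bool" where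
  "riemannian_submersion A g B g' F \<longleftrightarrow>
     DIM('e) > DIM('f) \<and> smooth_map A B F \<and> surj F \<and> (\<forall>p. surj (differential A B F p)) \<and>
     (\<forall>p. \<forall>v\<in>horiz A B g F p. vlength (g' (F p)) (differential A B F p v) = vlength (g p) v)"

definition vert_part ::
  "('a, 'e::euclidean_space) chart set \<Rightarrow> ('b, 'f::euclidean_space) chart set \<Rightarrow>
   ('a \<Rightarrow> 'e \<Rightarrow> 'e \<Rightarrow> real) \<Rightarrow> ('a \<Rightarrow> 'b) \<Rightarrow> ('a \<Rightarrow> 'e) \<Rightarrow> ('a \<Rightarrow> 'e)" where
  "vert_part A B g F X = (\<lambda>p. orth_proj (g p) (vert A B F p) (X p))"

definition horiz_part ::
  "('a, 'e::euclidean_space) chart set \<Rightarrow> ('b, 'f::euclidean_space) chart set \<Rightarrow>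
   ('a \<Rightarrow> 'e \<Rightarrow> 'e \<Rightarrow> real) \<Rightarrow> ('a \<Rightarrow> 'b) \<Rightarrow> ('a \<Rightarrow> 'e) \<Rightarrow> ('a \<Rightarrow> 'e)" where
  "horiz_part A B g F X = (\<lambda>p. orth_proj (g p) (horiz A B g F p) (X p))"

definition oneill_T ::
  "('a, 'e::euclidean_space) chart set \<Rightarrow> ('b, 'f::euclidean_space) chart set \<Rightarrow>
   ('a \<Rightarrow> 'e \<Rightarrow> 'e \<Rightarrow> real) \<Rightarrow> (('a \<Rightarrow> 'e) \<Rightarrow> ('a \<Rightarrow> 'e) \<Rightarrow> ('a \<Rightarrow> 'e)) \<Rightarrow> ('a \<Rightarrow> 'b) \<Rightarrow>
   ('a \<Rightarrow> 'e) \<Rightarrow> ('a \<Rightarrow> 'e) \<Rightarrow> ('a \<Rightarrow> 'e)" where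
  "oneill_T A B g nabla F E G = (\<lambda>p.
     horiz_part A B g F (nabla (vert_part A B g F E) (vert_part A B g F G)) p +
     vert_part A B g F (nabla (vert_part A B g F E) (horiz_part A B g F G)) p)"

definition bi_slant_submersion ::
  "('a::{t2_space, second_countable_topology}, 'e::euclidean_space) chart set \<Rightarrow>
   ('a \<Rightarrow> 'e \<Rightarrow> 'e) \<Rightarrow> ('a \<Rightarrow> 'e) \<Rightarrow> ('a \<Rightarrow> 'e \<Rightarrow> real) \<Rightarrow> ('a \<Rightarrow> 'e \<Rightarrow> 'e \<Rightarrow> real) \<Rightarrow>
   (('a \<Rightarrow> 'e) \<Rightarrow> ('a \<Rightarrow> 'e) \<Rightarrow> ('a \<Rightarrow> 'e)) \<Rightarrow>
   ('b::{t2_space, second_countable_topology}, 'f::euclidean_space) chart set \<Rightarrow>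
   ('b \<Rightarrow> 'f \<Rightarrow> 'f \<Rightarrow> real) \<Rightarrow> ('a \<Rightarrow> 'b) \<Rightarrow> ('a \<Rightarrow> 'e set) \<Rightarrow> ('a \<Rightarrow> 'e set) \<Rightarrow> real \<Rightarrow> real \<Rightarrow> bool"
  where
  "bi_slant_submersion A phi xi eta g nabla B g' F D1 D2 \<theta>1 \<theta>2 \<longleftrightarrow>
     smooth_atlas A \<and> riemannian_metric A g \<and> levi_civita A g nabla \<and>
     sasakian A phi xi eta g nabla \<and>
     smooth_atlas B \<and> riemannian_metric B g' \<and>
     riemannian_submersion A g B g' F \<and>
     (\<forall>p. xi p \<in> horiz A B g F p) \<and>
     distribution A D1 \<and> distribution A D2 \<and>
     (\<forall>p. vert A B F p = {u + v |u v. u \<in> D1 p \<and> v \<in> D2 p}) \<and>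
     (\<forall>p. \<forall>u\<in>D1 p. \<forall>v\<in>D2 p. g p u v = 0) \<and>
     (\<forall>p. \<forall>u\<in>D1 p. u \<noteq> 0 \<longrightarrow> subspace_angle (g p) (phi p u) (D1 p) = \<theta>1) \<and>
     (\<forall>p. \<forall>v\<in>D2 p. v \<noteq> 0 \<longrightarrow> subspace_angle (g p) (phi p v) (D2 p) = \<theta>2) \<and>
     (\<forall>p. \<forall>u\<in>D1 p. \<forall>v\<in>D2 p. g p (phi p u) v = 0 \<and> g p (phi p v) u = 0)"

end

theory Submission
  imports Defs
begin

text \<open>
  The contact form \<open>\<eta>\<close> vanishes on \<open>ker F\<^sub>*\<close> because \<open>\<xi>\<close> is horizontal, and \<open>ker F\<^sub>*\<close> is integrable;
  hence \<open>2 d\<eta>(U, V) = - \<eta>([U, V]) = 0\<close>, that is \<open>g(U, \<phi>V) = 0\<close>, for all vertical \<open>U, V\<close>. So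
  \<open>\<phi>\<close> maps \<open>ker F\<^sub>*\<close> into its orthogonal complement, the vertical parts of \<open>\<phi>U\<close> and \<open>\<phi>Z\<close> vanish
  (so the sign on the left of the first condition is immaterial), and, whatever the slant angles are,
  \<open>(\<nabla>\<^sub>W \<phi>)Z = g(W, Z)\<xi>\<close> turns the conditions into
  \<open>g(\<nabla>\<^sub>W Z, U) = 0\<close> and \<open>g(\<nabla>\<^sub>W Z, X) = 0\<close>. Bump functions provide enough global sections to
  conclude \<open>\<nabla>\<^sub>W Z \<in> D\<^sub>2\<close> from this, and enough test functions to recognise vertical brackets.
\<close>

subsection \<open>Closure properties of smooth functions and bump functions\<close>

lemma Ck_on_differentiable:
  assumes "open S" "Ck_on (Suc k) S f" "x \<in> S"
  shows "f differentiable (at x)"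
  using assms differentiable_on_eq_differentiable_at[of S f] by simp

lemma Ck_on_has_derivative:
  assumes "open S" "Ck_on (Suc k) S f" "x \<in> S"
  shows "(f has_derivative frechet_derivative f (at x)) (at x)"
  using Ck_on_differentiable[OF assms] by (simp add: frechet_derivative_works)

text \<open>A derivative depends on values near the point, so agreement passes to derivatives
  because \<open>S\<close> is open.\<close>

lemma Ck_on_cong:
  assumes "open S" "\<And>x. x \<in> S \<Longrightarrow> f x = h x" "Ck_on k S f"
  shows "Ck_on k S h"
  using assms(2,3)
proof (induction k arbitrary: f h)
  case 0
  then show ?case by (metis Ck_on.simps(1) continuous_on_cong)
next
  case (Suc k)
  have D: "(h has_derivative frechet_derivative f (at x)) (at x)" if "x \<in> S" for x
    using has_derivative_transform_within_open[OF Ck_on_has_derivative[OF assms(1) Suc.prems(2) that] assms(1) that]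
      Suc.prems(1) by blast
  have "h differentiable_on S"
    using D by (meson differentiableI differentiable_at_imp_differentiable_on)
  moreover have "Ck_on k S (\<lambda>x. frechet_derivative h (at x) v)" for v
  proof (rule Suc.IH[of "\<lambda>x. frechet_derivative f (at x) v"])
    fix x assume "x \<in> S"
    then show "frechet_derivative f (at x) v = frechet_derivative h (at x) v"
      using frechet_derivative_at[OF D] by metis
  qed (use Suc.prems in auto)
  ultimately show ?case by simp
qed

text \<open>Lets the derivative be supplied as an explicit formula. It agrees with
  \<open>frechet_derivative\<close> at the points of \<open>S\<close>, and \<open>Ck_on_cong\<close>
  transfers the regularity from one to the other.\<close>

lemma Ck_on_SucI:
  assumes "open S" "\<And>x. x \<in> S \<Longrightarrow> (f has_derivative f' x) (at x)"
    "\<And>v. Ck_on k S (\<lambda>x. f' x v)"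
  shows "Ck_on (Suc k) S f"
proof -
  have "f differentiable_on S"
    using assms(2) by (meson differentiableI differentiable_at_imp_differentiable_on)
  moreover have "Ck_on k S (\<lambda>x. frechet_derivative f (at x) v)" for v
    by (rule Ck_on_cong[OF assms(1) _ assms(3)[of v]])
      (metis assms(2) frechet_derivative_at)
  ultimately show ?thesis by simp
qed

lemma Ck_on_subset: "Ck_on k S f \<Longrightarrow> T \<subseteq> S \<Longrightarrow> Ck_on k T f"
  by (induction k arbitrary: f) (auto intro: continuous_on_subset differentiable_on_subset)

text \<open>On a manifold smoothness is checked around each point in a neighbourhood chosen for that
  point; this criterion glues the results, for instance for functions extended by zero.\<close>

lemma Ck_on_local:
  assumes "\<And>x. x \<in> S \<Longrightarrow> \<exists>T. open T \<and> x \<in> T \<and> Ck_on k T f"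
  shows "Ck_on k S f"
  using assms
proof (induction k arbitrary: f)
  case 0
  have "isCont f x" if "x \<in> S" for x
    using 0[OF that] by (auto simp: continuous_on_eq_continuous_at)
  then show ?case by (simp add: continuous_at_imp_continuous_on)
next
  case (Suc k)
  have "f differentiable at x" if "x \<in> S" for x
    using Suc.prems[OF that] Ck_on_differentiable by blast
  moreover have "Ck_on k S (\<lambda>x. frechet_derivative f (at x) v)" for v
  proof (rule Suc.IH)
    fix x assume "x \<in> S"
    then obtain T where "open T" "x \<in> T" "Ck_on (Suc k) T f" using Suc.prems by blast
    then show "\<exists>T. open T \<and> x \<in> T \<and> Ck_on k T (\<lambda>x. frechet_derivative f (at x) v)"
      by auto
  qed
  ultimately show ?case
    by (simp add: differentiable_at_imp_differentiable_on)
qed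

text \<open>The product and chain rules mix derivatives with undifferentiated factors, and the
  latter have to be brought down to order \<open>k\<close>.\<close>

lemma Ck_on_lower: "Ck_on (Suc k) S f \<Longrightarrow> Ck_on k S f"
proof (induction k arbitrary: f)
  case 0
  then show ?case by (simp add: differentiable_imp_continuous_on)
next
  case (Suc k)
  have "Ck_on k S (\<lambda>x. frechet_derivative f (at x) v)" for v
    using Suc.prems by (intro Suc.IH) simp
  with Suc.prems show ?case by simp
qed

lemma Ck_on_const: "open S \<Longrightarrow> Ck_on k S (\<lambda>x. c)"
  by (induction k arbitrary: c) simp_all

lemma Ck_on_add:
  "open S \<Longrightarrow> Ck_on k S f \<Longrightarrow> Ck_on k S h \<Longrightarrow> Ck_on k S (\<lambda>x. f x + h x)"
proof (induction k arbitrary: f h)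
  case (Suc k)
  note D = Ck_on_has_derivative[OF Suc.prems(1)]
  have "Ck_on k S (\<lambda>x. frechet_derivative f (at x) v + frechet_derivative h (at x) v)" for v
    using Suc.prems by (intro Suc.IH) auto
  then show ?case
    by (rule Ck_on_SucI[OF Suc.prems(1), rotated])
      (rule has_derivative_add[OF D[OF Suc.prems(2)] D[OF Suc.prems(3)]])
qed (simp add: continuous_on_add)

lemma Ck_on_sum:
  "open S \<Longrightarrow> (\<And>i. i \<in> I \<Longrightarrow> Ck_on k S (f i)) \<Longrightarrow> Ck_on k S (\<lambda>x. \<Sum>i\<in>I. f i x)"
  by (induction I rule: infinite_finite_induct) (auto intro: Ck_on_const Ck_on_add)

lemma Ck_on_bounded_linear:
  assumes "bounded_linear L" "open S"
  shows "Ck_on k S f \<Longrightarrow> Ck_on k S (\<lambda>x. L (f x))"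
proof (induction k arbitrary: f)
  case 0
  then show ?case by (simp add: bounded_linear.continuous_on[OF assms(1)])
next
  case (Suc k)
  have "Ck_on k S (\<lambda>x. L (frechet_derivative f (at x) v))" for v
    using Suc.prems by (intro Suc.IH) simp
  then show ?case
    by (rule Ck_on_SucI[OF assms(2), where f' = "\<lambda>x v. L (frechet_derivative f (at x) v)", rotated])
      (rule bounded_linear.has_derivative[OF assms(1) Ck_on_has_derivative[OF assms(2) Suc.prems]])
qed

lemma Ck_on_scaleR:
  "open S \<Longrightarrow> Ck_on k S f \<Longrightarrow> Ck_on k S h \<Longrightarrow> Ck_on k S (\<lambda>x. f x *\<^sub>R h x)"
proof (induction k arbitrary: f h)
  case (Suc k)
  note D = Ck_on_has_derivative[OF Suc.prems(1)]
  have *: "Ck_on k S (\<lambda>x. f x *\<^sub>R frechet_derivative h (at x) v + frechet_derivative f (at x) v *\<^sub>R h x)" for v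
  proof -
    have "Ck_on k S (\<lambda>x. frechet_derivative h (at x) v)" "Ck_on k S (\<lambda>x. frechet_derivative f (at x) v)"
      using Suc.prems(2,3) by simp_all
    then show ?thesis
      by (intro Ck_on_add[OF Suc.prems(1) Suc.IH[OF Suc.prems(1)] Suc.IH[OF Suc.prems(1)]]
          Suc.prems(2,3)[THEN Ck_on_lower])
  qed
  show ?case
    by (rule Ck_on_SucI[OF Suc.prems(1) _ *])
      (rule has_derivative_scaleR[OF D[OF Suc.prems(2)] D[OF Suc.prems(3)]])
qed (simp add: continuous_on_scaleR)

lemma Ck_on_compose:
  assumes "open S" "open T" "f ` S \<subseteq> T"
  shows "Ck_on k T h \<Longrightarrow> Ck_on k S f \<Longrightarrow> Ck_on k S (\<lambda>x. h (f x))"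
proof (induction k arbitrary: h)
  case 0
  then show ?case
    using continuous_on_compose2[OF _ _ assms(3), of h] by simp
next
  case (Suc k)
  show ?case
  proof (rule Ck_on_SucI[OF assms(1)])
    fix x assume x: "x \<in> S"
    let ?h' = "frechet_derivative h (at (f x))"
    let ?f' = "frechet_derivative f (at x)"
    have h: "(h has_derivative ?h') (at (f x))"
      by (rule Ck_on_has_derivative[OF assms(2) Suc.prems(1)]) (use x assms(3) in auto)
    have "((\<lambda>x. h (f x)) has_derivative (\<lambda>v. ?h' (?f' v))) (at x)"
      by (rule has_derivative_compose[OF Ck_on_has_derivative[OF assms(1) Suc.prems(2) x] h])
    \<comment> \<open>The induction hypothesis covers derivatives of \<open>h\<close> in fixed
      directions only, so the moving direction \<open>?f' v\<close> is expanded in the standard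
      basis.\<close>
    moreover have "?h' (?f' v) = (\<Sum>b\<in>Basis. (?f' v \<bullet> b) *\<^sub>R ?h' b)" for v
    proof -
      have "?h' (\<Sum>b\<in>Basis. (?f' v \<bullet> b) *\<^sub>R b) = (\<Sum>b\<in>Basis. (?f' v \<bullet> b) *\<^sub>R ?h' b)"
        using has_derivative_linear[OF h] by (simp only: linear_sum linear_scale)
      then show ?thesis by (simp only: euclidean_representation)
    qed
    ultimately show "((\<lambda>x. h (f x)) has_derivative (\<lambda>v. \<Sum>b\<in>Basis. (?f' v \<bullet> b) *\<^sub>R ?h' b)) (at x)"
      by simp
  next
    fix v
    show "Ck_on k S (\<lambda>x. \<Sum>b\<in>Basis. (frechet_derivative f (at x) v \<bullet> b) *\<^sub>R frechet_derivative h (at (f x)) b)"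
    proof (intro Ck_on_sum Ck_on_scaleR assms(1))
      fix b :: 'b assume "b \<in> Basis"
      show "Ck_on k S (\<lambda>x. frechet_derivative f (at x) v \<bullet> b)"
        by (rule Ck_on_bounded_linear) (use Suc.prems assms(1) in \<open>auto intro: bounded_linear_inner_left\<close>)
      show "Ck_on k S (\<lambda>x. frechet_derivative h (at (f x)) b)"
        using Suc.prems(1) by (intro Suc.IH Ck_on_lower[OF Suc.prems(2)]) simp
    qed
  qed
qed

lemma Ck_on_id: "open S \<Longrightarrow> Ck_on k S (\<lambda>x. x)"
  by (cases k) (simp_all add: Ck_on_const differentiable_on_def)

section \<open>The same closure properties for smooth functions\<close>

lemma smooth_on_cong: "open S \<Longrightarrow> (\<And>x. x \<in> S \<Longrightarrow> f x = h x) \<Longrightarrow> smooth_on S f \<Longrightarrow> smooth_on S h"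
  using Ck_on_cong[of S f h] by (simp add: smooth_on_def)

lemma smooth_on_subset: "smooth_on S f \<Longrightarrow> T \<subseteq> S \<Longrightarrow> smooth_on T f"
  using Ck_on_subset[of _ S f T] by (simp add: smooth_on_def)

lemma smooth_on_local:
  "(\<And>x. x \<in> S \<Longrightarrow> \<exists>T. open T \<and> x \<in> T \<and> smooth_on T f) \<Longrightarrow> smooth_on S f"
  unfolding smooth_on_def by (intro allI Ck_on_local) blast

lemma smooth_on_const: "open S \<Longrightarrow> smooth_on S (\<lambda>x. c)"
  by (simp add: smooth_on_def Ck_on_const)

lemma smooth_on_id: "open S \<Longrightarrow> smooth_on S (\<lambda>x. x)"
  by (simp add: smooth_on_def Ck_on_id)

lemma smooth_on_add:
  "open S \<Longrightarrow> smooth_on S f \<Longrightarrow> smooth_on S h \<Longrightarrow> smooth_on S (\<lambda>x. f x + h x)"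
  by (simp add: smooth_on_def Ck_on_add)

lemma smooth_on_scaleR:
  "open S \<Longrightarrow> smooth_on S f \<Longrightarrow> smooth_on S h \<Longrightarrow> smooth_on S (\<lambda>x. f x *\<^sub>R h x)"
  by (simp add: smooth_on_def Ck_on_scaleR del: real_scaleR_def)

lemma smooth_on_sum:
  "open S \<Longrightarrow> (\<And>i. i \<in> I \<Longrightarrow> smooth_on S (f i)) \<Longrightarrow> smooth_on S (\<lambda>x. \<Sum>i\<in>I. f i x)"
  by (simp add: smooth_on_def Ck_on_sum)

lemma smooth_on_bounded_linear:
  "bounded_linear L \<Longrightarrow> open S \<Longrightarrow> smooth_on S f \<Longrightarrow> smooth_on S (\<lambda>x. L (f x))"
  by (simp add: smooth_on_def Ck_on_bounded_linear)

lemma smooth_on_compose: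
  "open S \<Longrightarrow> open T \<Longrightarrow> f ` S \<subseteq> T \<Longrightarrow> smooth_on T h \<Longrightarrow> smooth_on S f \<Longrightarrow> smooth_on S (\<lambda>x. h (f x))"
  using Ck_on_compose[of S T f _ h] by (simp add: smooth_on_def)

lemma smooth_on_differentiable:
  "open S \<Longrightarrow> smooth_on S f \<Longrightarrow> x \<in> S \<Longrightarrow> f differentiable (at x)"
  unfolding smooth_on_def by (rule Ck_on_differentiable[of S 0]) auto

section \<open>Bump functions built from exp(-1/x)\<close>

definition flat :: "nat \<Rightarrow> real \<Rightarrow> real" where
  "flat n x = (if x > 0 then (1 / x) ^ n * exp (- (1 / x)) else 0)"

text \<open>The substitution of 1/x, which tends to infinity as x tends to 0 from the right, reduces
  this to the decay of a power divided by the exponential.\<close>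

lemma flat_tendsto_0: "((\<lambda>x. (1 / x) ^ n * exp (- (1 / x))) \<longlongrightarrow> (0::real)) (at_right 0)"
proof -
  have "((\<lambda>x::real. x ^ n / exp x) \<longlongrightarrow> 0) at_top"
    by (rule tendsto_power_div_exp_0)
  from filterlim_compose[OF this filterlim_inverse_at_top_right]
  show ?thesis by (simp add: divide_inverse exp_minus)
qed

text \<open>The powers of 1/x make the linear span of the family \<open>flat n\<close> closed under
  differentiation, so smoothness of all members follows by one induction over the order.\<close>

lemma flat_has_derivative:
  "(flat n has_real_derivative flat (n + 2) x - n * flat (n + 1) x) (at x)"
proof -
  consider "x > 0" | "x < 0" | "x = 0" by linarith
  then show ?thesis
  proof cases
    case 1
    have "((\<lambda>x. (1 / x) ^ n * exp (- (1 / x))) has_real_derivative flat (n + 2) x - n * flat (n + 1) x) (at x)"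
      using 1
      by (cases n)
        (auto intro!: derivative_eq_intros simp: flat_def field_simps power2_eq_square,
          metis One_nat_def power_eq_if)
    then show ?thesis
      by (rule has_field_derivative_transform_within_open[where S="{0<..}"]) (use 1 in \<open>auto simp: flat_def\<close>)
  next
    case 2
    have "((\<lambda>x. 0) has_real_derivative flat (n + 2) x - n * flat (n + 1) x) (at x)"
      using 2 by (simp add: flat_def)
    then show ?thesis
      by (rule has_field_derivative_transform_within_open[where S="{..<0}"]) (use 2 in \<open>auto simp: flat_def\<close>)
  next
    case 3
    \<comment> \<open>To the right of 0 the difference quotient \<open>flat n h / h\<close> is
      \<open>flat (Suc n) h\<close>, so the limit at 0 is the previous one with a higher
      power.\<close>
    have "((\<lambda>h. flat n h / h) \<longlongrightarrow> 0) (at_right 0)"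
      by (rule tendsto_cong[THEN iffD1, OF _ flat_tendsto_0[of "Suc n"]])
        (auto simp: eventually_at_filter flat_def field_simps)
    moreover have "((\<lambda>h. flat n h / h) \<longlongrightarrow> 0) (at_left 0)"
      by (rule tendsto_cong[THEN iffD1, OF _ tendsto_const])
        (auto simp: eventually_at_filter flat_def)
    ultimately show ?thesis
      using 3 by (simp add: has_field_derivative_def[symmetric] DERIV_def filterlim_split_at flat_def)
  qed
qed

lemma smooth_on_flat: "smooth_on UNIV (flat n)"
proof -
  have "Ck_on k UNIV (flat n)" for k
  proof (induction k arbitrary: n)
    case 0
    show ?case by (simp add: continuous_at_imp_continuous_on DERIV_isCont[OF flat_has_derivative])
  next
    case (Suc k)
    have "Ck_on k UNIV (\<lambda>x. v *\<^sub>R flat (n + 2) x + (- n * v) *\<^sub>R flat (n + 1) x)" for v :: real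
      by (intro Ck_on_add Ck_on_scaleR Ck_on_const Suc) auto
    moreover have "(flat n has_derivative (\<lambda>v. v *\<^sub>R flat (n + 2) x + (- n * v) *\<^sub>R flat (n + 1) x)) (at x)" for x
      using flat_has_derivative[of n x]
      by (simp add: has_field_derivative_def algebra_simps)
        (erule has_derivative_eq_rhs, simp add: fun_eq_iff algebra_simps)
    ultimately show ?case by (intro Ck_on_SucI) auto
  qed
  then show ?thesis by (simp add: smooth_on_def)
qed

text \<open>The squared distance keeps the argument of \<open>flat 0\<close> smooth at
  \<open>a\<close>. For \<open>r > 0\<close> this argument is positive exactly on the open ball;
  positivity at the centre is what the cutoffs below use, in place of a plateau of value 1.\<close>

definition bump :: "'e::euclidean_space \<Rightarrow> real \<Rightarrow> 'e \<Rightarrow> real" where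
  "bump a r z = flat 0 (r\<^sup>2 - (z - a) \<bullet> (z - a))"

lemma smooth_on_bump: "smooth_on UNIV (bump a r)"
proof -
  have c: "smooth_on UNIV (\<lambda>z. (z - a) \<bullet> b)" for b
    using smooth_on_add[OF _ smooth_on_bounded_linear[OF bounded_linear_inner_left[of b] _ smooth_on_id]
        smooth_on_const[of _ "- (a \<bullet> b)"], of UNIV]
    by (simp add: inner_diff_left)
  have "smooth_on UNIV (\<lambda>z. ((z - a) \<bullet> b) *\<^sub>R ((z - a) \<bullet> b))" for b
    by (intro smooth_on_scaleR c) auto
  then have "smooth_on UNIV (\<lambda>z. \<Sum>b\<in>Basis. ((z - a) \<bullet> b) *\<^sub>R ((z - a) \<bullet> b))"
    by (intro smooth_on_sum) auto
  then have "smooth_on UNIV (\<lambda>z. (z - a) \<bullet> (z - a))"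
    by (subst euclidean_inner) simp
  then have "smooth_on UNIV (\<lambda>z. r\<^sup>2 + (-1) *\<^sub>R ((z - a) \<bullet> (z - a)))"
    by (intro smooth_on_add smooth_on_scaleR smooth_on_const) auto
  then have "smooth_on UNIV (\<lambda>z. r\<^sup>2 - (z - a) \<bullet> (z - a))" by simp
  from smooth_on_compose[OF _ _ _ smooth_on_flat this] show ?thesis
    by (simp add: bump_def[abs_def])
qed

lemma bump_center: "r > 0 \<Longrightarrow> bump a r a > 0"
  by (simp add: bump_def flat_def)

lemma bump_outside: "r > 0 \<Longrightarrow> z \<notin> cball a r \<Longrightarrow> bump a r z = 0"
proof -
  assume "r > 0" "z \<notin> cball a r"
  then have "r < norm (z - a)" by (simp add: dist_norm norm_minus_commute)
  then have "r\<^sup>2 \<le> (norm (z - a))\<^sup>2" using \<open>r > 0\<close> by (intro power_mono) auto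
  then show ?thesis by (simp add: bump_def flat_def power2_norm_eq_inner)
qed

subsection \<open>Smooth manifolds\<close>

locale smooth_manifold =
  fixes A :: "('a::{t2_space, second_countable_topology}, 'e::euclidean_space) chart set"
  assumes atlas: "smooth_atlas A"
begin

lemma chart: "c \<in> A \<Longrightarrow> is_chart c"
  using atlas by (auto simp: smooth_atlas_def)

lemma open_chart_domain: "c \<in> A \<Longrightarrow> open (fst c)"
  using chart by (auto simp: is_chart_def)

lemma chart_homeomorphism:
  "c \<in> A \<Longrightarrow> homeomorphism (fst c) (snd c ` fst c) (snd c) (chart_inv c)"
  using chart by (auto simp: is_chart_def)

lemma chart_inv_snd [simp]: "c \<in> A \<Longrightarrow> p \<in> fst c \<Longrightarrow> chart_inv c (snd c p) = p"
  using chart_homeomorphism by (auto simp: homeomorphism_def)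

lemma open_chart_image:
  assumes "c \<in> A" "open W"
  shows "open (snd c ` (fst c \<inter> W))"
proof -
  have "openin (top_of_set (snd c ` fst c)) (snd c ` (fst c \<inter> W))"
    by (rule homeomorphism_imp_open_map[OF chart_homeomorphism[OF assms(1)]])
      (use assms(2) in auto)
  moreover have "open (snd c ` fst c)"
    using chart[OF assms(1)] by (simp add: is_chart_def)
  ultimately show ?thesis by (rule openin_open_trans)
qed

lemma open_chart_image_domain: "c \<in> A \<Longrightarrow> open (snd c ` fst c)"
  using chart by (auto simp: is_chart_def)

lemma smooth_transition:
  "c \<in> A \<Longrightarrow> d \<in> A \<Longrightarrow> smooth_on (snd c ` (fst c \<inter> fst d)) (snd d \<circ> chart_inv c)"
  using atlas by (auto simp: smooth_atlas_def)

lemma chart_at: "chart_at A p \<in> A" "p \<in> fst (chart_at A p)"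
proof -
  have "\<exists>c. c \<in> A \<and> p \<in> fst c"
    using atlas unfolding smooth_atlas_def by (metis UN_E UNIV_I)
  then have "chart_at A p \<in> A \<and> p \<in> fst (chart_at A p)"
    unfolding chart_at_def by (rule someI_ex)
  then show "chart_at A p \<in> A" "p \<in> fst (chart_at A p)" by auto
qed

text \<open>\<open>frechet_derivative\<close> is known to be linear only where the map is
  differentiable; here the map is a transition map, smooth on the overlap of the two charts.\<close>

lemma linear_components:
  assumes "c \<in> A" "p \<in> fst c"
  shows "linear (components A c p)"
proof -
  let ?d = "chart_at A p"
  have "(snd c \<circ> chart_inv ?d) differentiable at (snd ?d p)"
    by (rule smooth_on_differentiable[OF open_chart_image smooth_transition])
      (use assms chart_at open_chart_domain in auto)
  then show ?thesis
    unfolding components_def by (metis linear_frechet_derivative eta_contract_eq)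
qed

lemma linear_deriv:
  assumes "smooth_fun A f"
  shows "linear (frechet_derivative (f \<circ> chart_inv (chart_at A p)) (at (snd (chart_at A p) p)))"
proof -
  let ?d = "chart_at A p"
  have "(f \<circ> chart_inv ?d) differentiable at (snd ?d p)"
    by (rule smooth_on_differentiable[OF open_chart_image_domain])
      (use assms chart_at in \<open>auto simp: smooth_fun_def\<close>)
  then show ?thesis by (rule linear_frechet_derivative)
qed

section \<open>Operations on smooth functions and vector fields\<close>

lemma smooth_fun_const: "smooth_fun A (\<lambda>p. r)"
  using open_chart_image_domain by (auto simp: smooth_fun_def o_def intro: smooth_on_const)

lemma smooth_fun_mult:
  assumes "smooth_fun A f" "smooth_fun A h"
  shows "smooth_fun A (\<lambda>p. f p * h p)"
  unfolding smooth_fun_def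
proof
  fix c assume c: "c \<in> A"
  then have "smooth_on (snd c ` fst c) (\<lambda>z. (f \<circ> chart_inv c) z *\<^sub>R (h \<circ> chart_inv c) z)"
    using assms c
    by (intro smooth_on_scaleR open_chart_image_domain) (auto simp: smooth_fun_def simp del: o_apply)
  then show "smooth_on (snd c ` fst c) ((\<lambda>p. f p * h p) \<circ> chart_inv c)"
    by (simp add: o_def)
qed

lemma smooth_field_on_scaleR:
  assumes "open S" "smooth_fun A f" "smooth_field_on A S X"
  shows "smooth_field_on A S (\<lambda>p. f p *\<^sub>R X p)"
  unfolding smooth_field_on_def
proof
  fix c assume c: "c \<in> A"
  let ?S = "snd c ` (fst c \<inter> S)"
  have "smooth_on ?S (\<lambda>z. (f \<circ> chart_inv c) z *\<^sub>R components A c (chart_inv c z) (X (chart_inv c z)))"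
    using assms c by (intro smooth_on_scaleR open_chart_image)
      (auto simp: smooth_fun_def smooth_field_on_def simp del: o_apply intro: smooth_on_subset)
  then show "smooth_on ?S (\<lambda>z. components A c (chart_inv c z) (f (chart_inv c z) *\<^sub>R X (chart_inv c z)))"
    by (rule smooth_on_cong[OF open_chart_image[OF c assms(1)], rotated])
      (use c in \<open>auto simp: linear_components linear_scale\<close>)
qed

lemma smooth_field_on_add:
  assumes "open S" "smooth_field_on A S X" "smooth_field_on A S Y"
  shows "smooth_field_on A S (\<lambda>p. X p + Y p)"
  unfolding smooth_field_on_def
proof
  fix c assume c: "c \<in> A"
  let ?S = "snd c ` (fst c \<inter> S)"
  have "smooth_on ?S (\<lambda>z. components A c (chart_inv c z) (X (chart_inv c z)) +
      components A c (chart_inv c z) (Y (chart_inv c z)))"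
    using assms c by (intro smooth_on_add open_chart_image) (auto simp: smooth_field_on_def)
  then show "smooth_on ?S (\<lambda>z. components A c (chart_inv c z) (X (chart_inv c z) + Y (chart_inv c z)))"
    by (rule smooth_on_cong[OF open_chart_image[OF c assms(1)], rotated])
      (use c in \<open>auto simp: linear_components linear_add\<close>)
qed

lemma smooth_field_0: "smooth_field A (\<lambda>p. 0)"
  unfolding smooth_field_on_def
proof
  fix c assume c: "c \<in> A"
  show "smooth_on (snd c ` (fst c \<inter> UNIV)) (\<lambda>z. components A c (chart_inv c z) 0)"
    by (rule smooth_on_cong[OF open_chart_image[OF c open_UNIV] _ smooth_on_const[of _ 0]])
      (use c open_chart_image_domain in \<open>auto simp: linear_components linear_0\<close>)
qed

lemma smooth_field_diff:
  assumes "smooth_field A X" "smooth_field A Y"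
  shows "smooth_field A (\<lambda>p. X p - Y p)"
  using smooth_field_on_add[OF open_UNIV assms(1)
      smooth_field_on_scaleR[OF open_UNIV smooth_fun_const[of "-1"] assms(2)]] by simp

section \<open>Extension by zero and cutoff functions\<close>

lemma closed_chart_inv_image:
  assumes "c \<in> A" "compact C" "C \<subseteq> snd c ` fst c"
  shows "closed (chart_inv c ` C)"
proof -
  have "continuous_on C (chart_inv c)"
    using chart_homeomorphism[OF assms(1)] assms(3)
    by (auto simp: homeomorphism_def intro: continuous_on_subset)
  then show ?thesis
    using assms(2) compact_continuous_image compact_imp_closed by blast
qed

lemma smooth_fun_extend:
  fixes k :: "'e \<Rightarrow> real"
  assumes c: "c \<in> A" and C: "compact C" "C \<subseteq> snd c ` fst c"
    and k: "smooth_on UNIV k" "\<And>z. z \<notin> C \<Longrightarrow> k z = 0"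
  shows "smooth_fun A (\<lambda>q. if q \<in> fst c then k (snd c q) else 0)" (is "smooth_fun A ?f")
  unfolding smooth_fun_def
proof (intro ballI smooth_on_local)
  fix d z assume d: "d \<in> A" and "z \<in> snd d ` fst d"
  then obtain q where q: "q \<in> fst d" "z = snd d q" by auto
  show "\<exists>T. open T \<and> z \<in> T \<and> smooth_on T (?f \<circ> chart_inv d)"
  proof (cases "q \<in> fst c")
    case True
    let ?T = "snd d ` (fst d \<inter> fst c)"
    have o: "open ?T" using c d by (simp add: open_chart_image open_chart_domain)
    have "smooth_on ?T (\<lambda>z. k ((snd c \<circ> chart_inv d) z))"
      by (rule smooth_on_compose[OF o open_UNIV _ k(1) smooth_transition[OF d c]]) auto
    then have "smooth_on ?T (?f \<circ> chart_inv d)"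
      by (rule smooth_on_cong[OF o, rotated]) (use d in auto)
    then show ?thesis using o q True by blast
  next
    case False
    let ?K = "chart_inv c ` C"
    let ?T = "snd d ` (fst d \<inter> - ?K)"
    have o: "open ?T"
      using closed_chart_inv_image[OF c C] d by (simp add: open_chart_image open_Compl)
    have z: "?f q = 0" if "q \<notin> ?K" for q
      using that k(2)[of "snd c q"] c by (metis chart_inv_snd imageI)
    have "smooth_on ?T (?f \<circ> chart_inv d)"
      by (rule smooth_on_cong[OF o _ smooth_on_const[OF o, of 0]]) (use d z in fastforce)
    moreover have "q \<notin> ?K"
      using False C c by auto
    ultimately show ?thesis using o q by blast
  qed
qed

text \<open>A bump in the coordinates of the chart at \<open>p\<close>, supported in a closed ball
  that lies in the image of \<open>S\<close>. The closed set \<open>K\<close> is recorded so that a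
  field defined only on \<open>S\<close> can be extended by zero after multiplication by
  \<open>f\<close>.\<close>

lemma cutoff_exists:
  assumes "open S" "p \<in> S"
  obtains f K where "smooth_fun A f" "f p > 0" "closed K" "K \<subseteq> S" "\<And>q. q \<notin> K \<Longrightarrow> f q = 0"
proof -
  let ?c = "chart_at A p"
  have "snd ?c p \<in> snd ?c ` (fst ?c \<inter> S)" using assms chart_at by blast
  then obtain r where r: "r > 0" "cball (snd ?c p) r \<subseteq> snd ?c ` (fst ?c \<inter> S)"
    using open_chart_image[OF chart_at(1) assms(1)] open_contains_cball by blast
  let ?C = "cball (snd ?c p) r"
  let ?k = "bump (snd ?c p) r"
  let ?f = "\<lambda>q. if q \<in> fst ?c then ?k (snd ?c q) else 0"
  have C: "?C \<subseteq> snd ?c ` fst ?c" using r by blast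
  show ?thesis
  proof
    show "smooth_fun A ?f"
      by (rule smooth_fun_extend[OF chart_at(1) compact_cball C smooth_on_bump])
        (use r bump_outside in auto)
    show "?f p > 0" using chart_at r by (simp add: bump_center)
    show "closed (chart_inv ?c ` ?C)"
      by (rule closed_chart_inv_image[OF chart_at(1) compact_cball C])
    show "chart_inv ?c ` ?C \<subseteq> S"
    proof (rule image_subsetI)
      fix z assume "z \<in> ?C"
      then obtain q where "q \<in> fst ?c \<inter> S" "z = snd ?c q" using r by blast
      then show "chart_inv ?c z \<in> S" using chart_at by simp
    qed
    show "?f q = 0" if "q \<notin> chart_inv ?c ` ?C" for q
      using that bump_outside[OF r(1), of "snd ?c q" "snd ?c p"] chart_at(1)
      by (metis chart_inv_snd imageI)
  qed
qed

text \<open>Since \<open>K\<close> lies in \<open>S\<close>, the open sets \<open>S\<close> and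
  \<open>- K\<close> cover the manifold: on the first the product is smooth, on the second it is
  zero.\<close>

lemma smooth_field_cutoff:
  assumes S: "open S" "smooth_field_on A S X"
    and f: "smooth_fun A f" and K: "closed K" "K \<subseteq> S" "\<And>q. q \<notin> K \<Longrightarrow> f q = 0"
  shows "smooth_field A (\<lambda>q. f q *\<^sub>R X q)"
  unfolding smooth_field_on_def
proof (intro ballI smooth_on_local)
  fix d z assume d: "d \<in> A" and "z \<in> snd d ` (fst d \<inter> UNIV)"
  then obtain q where q: "q \<in> fst d" "z = snd d q" by auto
  let ?Y = "\<lambda>z. components A d (chart_inv d z) (f (chart_inv d z) *\<^sub>R X (chart_inv d z))"
  show "\<exists>T. open T \<and> z \<in> T \<and> smooth_on T ?Y"
  proof (cases "q \<in> S")
    case True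
    have "smooth_on (snd d ` (fst d \<inter> S)) ?Y"
      using smooth_field_on_scaleR[OF S(1) f S(2)] d by (auto simp: smooth_field_on_def)
    then show ?thesis using True q open_chart_image[OF d S(1)] by blast
  next
    case False
    let ?T = "snd d ` (fst d \<inter> - K)"
    have o: "open ?T" using K d by (simp add: open_chart_image open_Compl)
    have "smooth_on ?T ?Y"
      by (rule smooth_on_cong[OF o _ smooth_on_const[OF o, of 0]])
        (use d K in \<open>auto simp: linear_components linear_0\<close>)
    then show ?thesis using False q o K by blast
  qed
qed

text \<open>Near each point the composite is factored through a chart of the base around the image
  point. The second claim is the chain rule d(h o F) = dh o dF, read in the charts fixed at
  \<open>p\<close> and at \<open>F p\<close>.\<close>

lemma smooth_map_comp:
  assumes "smooth_manifold B" "smooth_map A B F" "smooth_fun B h"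
  shows "smooth_fun A (h \<circ> F)"
    and "frechet_derivative (h \<circ> F \<circ> chart_inv (chart_at A p)) (at (snd (chart_at A p) p)) v =
      frechet_derivative (h \<circ> chart_inv (chart_at B (F p))) (at (snd (chart_at B (F p)) (F p)))
        (differential A B F p v)"
proof -
  interpret B: smooth_manifold B by fact
  have F: "open (F -` U)" if "open U" for U
    using assms(2) that by (simp add: smooth_map_def continuous_on_open_vimage)
  let ?S = "\<lambda>c d. snd c ` (fst c \<inter> F -` fst d)"
  let ?F = "\<lambda>c d. snd d \<circ> F \<circ> chart_inv c"
  have o: "open (?S c d)" if "c \<in> A" "d \<in> B" for c d
    using that by (simp add: open_chart_image F B.open_chart_domain)
  have sF: "smooth_on (?S c d) (?F c d)" if "c \<in> A" "d \<in> B" for c d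
    using assms(2) that by (simp add: smooth_map_def)
  have h: "smooth_on (snd d ` fst d) (h \<circ> chart_inv d)" if "d \<in> B" for d
    using assms(3) that by (simp add: smooth_fun_def)
  have eq: "(h \<circ> chart_inv d) (?F c d z) = (h \<circ> F \<circ> chart_inv c) z"
    if "c \<in> A" "d \<in> B" "z \<in> ?S c d" for c d z
    using that by auto
  show "smooth_fun A (h \<circ> F)"
    unfolding smooth_fun_def
  proof (intro ballI smooth_on_local)
    fix c z assume c: "c \<in> A" and "z \<in> snd c ` fst c"
    then obtain q where q: "q \<in> fst c" "z = snd c q" by auto
    let ?d = "chart_at B (F q)"
    have d: "?d \<in> B" by (rule B.chart_at)
    have "smooth_on (?S c ?d) (\<lambda>z. (h \<circ> chart_inv ?d) (?F c ?d z))"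
      by (rule smooth_on_compose[OF o[OF c d] B.open_chart_image_domain[OF d] _ h[OF d] sF[OF c d]])
        (use c d in auto)
    then have "smooth_on (?S c ?d) (h \<circ> F \<circ> chart_inv c)"
      by (rule smooth_on_cong[OF o[OF c d], rotated]) (rule eq[OF c d])
    then show "\<exists>T. open T \<and> z \<in> T \<and> smooth_on T (h \<circ> F \<circ> chart_inv c)"
      using o[OF c d] q B.chart_at(2) by blast
  qed
  let ?c = "chart_at A p"
  let ?d = "chart_at B (F p)"
  have c: "?c \<in> A" "p \<in> fst ?c" and d: "?d \<in> B" "F p \<in> fst ?d"
    by (rule chart_at B.chart_at)+
  have p: "snd ?c p \<in> ?S ?c ?d" using c d by blast
  have "(?F ?c ?d) differentiable (at (snd ?c p))"
    by (rule smooth_on_differentiable[OF o sF p]) (use c d in auto)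
  moreover have "(h \<circ> chart_inv ?d) differentiable (at (snd ?d (F p)))"
    by (rule smooth_on_differentiable[OF B.open_chart_image_domain h]) (use d in auto)
  moreover have "?F ?c ?d (snd ?c p) = snd ?d (F p)" using c by simp
  ultimately have "((\<lambda>z. (h \<circ> chart_inv ?d) (?F ?c ?d z)) has_derivative
      (\<lambda>v. frechet_derivative (h \<circ> chart_inv ?d) (at (snd ?d (F p))) (differential A B F p v))) (at (snd ?c p))"
    unfolding differential_def frechet_derivative_works
    by (metis has_derivative_compose)
  then have "(h \<circ> F \<circ> chart_inv ?c has_derivative
      (\<lambda>v. frechet_derivative (h \<circ> chart_inv ?d) (at (snd ?d (F p))) (differential A B F p v))) (at (snd ?c p))"
    by (rule has_derivative_transform_within_open[OF _ o p]) (use c d eq in auto)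
  then show "frechet_derivative (h \<circ> F \<circ> chart_inv ?c) (at (snd ?c p)) v =
      frechet_derivative (h \<circ> chart_inv ?d) (at (snd ?d (F p))) (differential A B F p v)"
    by (metis frechet_derivative_at)
qed

text \<open>Supplies test functions that separate tangent vectors: if every smooth function has
  derivative zero in the direction \<open>v\<close>, then \<open>v\<close> is zero.\<close>

lemma smooth_fun_with_derivative:
  obtains h where "smooth_fun A h"
    "frechet_derivative (h \<circ> chart_inv (chart_at A p)) (at (snd (chart_at A p) p)) v = v \<bullet> v"
proof -
  let ?c = "chart_at A p"
  let ?a = "snd ?c p"
  have c: "?c \<in> A" "p \<in> fst ?c" by (rule chart_at)+
  then obtain r where r: "r > 0" "cball ?a r \<subseteq> snd ?c ` fst ?c"
    using open_chart_image_domain[OF c(1)] open_contains_cball by blast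
  let ?b = "bump ?a r"
  \<comment> \<open>A bump normalised to 1 at \<open>?a\<close> times a linear function of
    \<open>z - ?a\<close>. The linear factor vanishes at \<open>?a\<close>, so the derivative of the
    bump does not contribute there.\<close>
  define k where "k = (\<lambda>z. (1 / ?b ?a) *\<^sub>R ?b z *\<^sub>R ((z + - ?a) \<bullet> v))"
  define h where "h = (\<lambda>q. if q \<in> fst ?c then k (snd ?c q) else 0)"
  have b: "?b ?a > 0" by (rule bump_center[OF r(1)])
  have "smooth_on UNIV k"
    unfolding k_def
    by (intro smooth_on_scaleR smooth_on_const smooth_on_bump smooth_on_add smooth_on_id
        smooth_on_bounded_linear[OF bounded_linear_inner_left] open_UNIV)
  then have h: "smooth_fun A h"
    unfolding h_def
    by (intro smooth_fun_extend[OF c(1) compact_cball r(2)])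
      (simp_all add: k_def bump_outside[OF r(1)])
  have "(?b has_derivative frechet_derivative ?b (at ?a)) (at ?a)"
    using smooth_on_differentiable[OF open_UNIV smooth_on_bump] frechet_derivative_works by blast
  then have "(k has_derivative (\<lambda>u. u \<bullet> v)) (at ?a)"
    unfolding k_def using b by (auto intro!: derivative_eq_intros)
  then have "(h \<circ> chart_inv ?c has_derivative (\<lambda>u. u \<bullet> v)) (at ?a)"
    by (rule has_derivative_transform_within_open[OF _ open_chart_image_domain[OF c(1)]])
      (use c in \<open>auto simp: h_def\<close>)
  then show thesis
    using that[OF h] by (metis frechet_derivative_at)
qed

lemma deriv_along_const: "deriv_along A X (\<lambda>p. r) p = 0"
  by (simp add: deriv_along_def o_def)

end

subsection \<open>Orthogonalisation on Riemannian manifolds\<close>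

text \<open>Gram--Schmidt without division: on smooth fields all coefficients stay smooth functions even
  where the fields become linearly dependent.\<close>

primrec gram_schmidt :: "('v \<Rightarrow> 'v \<Rightarrow> real) \<Rightarrow> (nat \<Rightarrow> 'v) \<Rightarrow> nat \<Rightarrow> 'v \<Rightarrow> 'v::real_vector" where
  "gram_schmidt b x 0 w = w"
| "gram_schmidt b x (Suc j) w =
     b (gram_schmidt b x j (x j)) (gram_schmidt b x j (x j)) *\<^sub>R gram_schmidt b x j w
     - b (gram_schmidt b x j w) (gram_schmidt b x j (x j)) *\<^sub>R gram_schmidt b x j (x j)"

section \<open>Gram-Schmidt and orthogonal projection in one tangent space\<close>

locale inner_form =
  fixes b :: "'v::euclidean_space \<Rightarrow> 'v \<Rightarrow> real"
  assumes bilinear: "bilinear b"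
    and commute: "b u v = b v u"
    and pos: "v \<noteq> 0 \<Longrightarrow> b v v > 0"
begin

lemmas simps =
  bilinear_ladd[OF bilinear] bilinear_radd[OF bilinear] bilinear_lsub[OF bilinear]
  bilinear_rsub[OF bilinear] bilinear_lmul[OF bilinear] bilinear_rmul[OF bilinear]
  bilinear_lneg[OF bilinear] bilinear_rneg[OF bilinear]
  bilinear_lzero[OF bilinear] bilinear_rzero[OF bilinear]

lemma eq_0: "b v v = 0 \<Longrightarrow> v = 0"
  using pos by force

lemma subspace_orthogonal: "subspace {v. \<forall>u\<in>S. b v u = 0}"
  by (auto simp: subspace_def simps)

lemma orthogonal_span: "(\<And>u. u \<in> S \<Longrightarrow> b v u = 0) \<Longrightarrow> u \<in> span S \<Longrightarrow> b v u = 0"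
  using span_minimal[of S "{u. b v u = 0}"] by (auto simp: subspace_def simps)

text \<open>The scalar \<open>c\<close>, common to all \<open>w\<close>, is the product of the
  squared lengths of the orthogonalised vectors \<open>gram_schmidt b x i (x i)\<close> for
  \<open>i < j\<close>. It vanishes only if one of these vectors or an earlier stage degenerates,
  and then the whole map is zero; for independent vectors all factors are positive.\<close>

lemma gram_schmidt_form:
  "\<exists>c. (\<forall>w. \<exists>s\<in>span (x ` {..<j}). gram_schmidt b x j w = c *\<^sub>R w - s) \<and>
     (c = 0 \<longrightarrow> (\<forall>w. gram_schmidt b x j w = 0)) \<and>
     ((\<forall>i<j. x i \<notin> span (x ` {..<i})) \<longrightarrow> c > 0)"
proof (induction j)
  case 0
  show ?case by (rule exI[of _ 1]) (simp add: span_zero)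
next
  case (Suc j)
  let ?gs = "gram_schmidt b x j"
  let ?e = "?gs (x j)"
  let ?S = "span (x ` {..<Suc j})"
  from Suc obtain c where c: "\<And>w. \<exists>s\<in>span (x ` {..<j}). ?gs w = c *\<^sub>R w - s"
    "c = 0 \<Longrightarrow> ?gs w = 0" "(\<forall>i<j. x i \<notin> span (x ` {..<i})) \<Longrightarrow> c > 0" for w
    by metis
  have sub: "s \<in> ?S" if "s \<in> span (x ` {..<j})" for s
    using that span_mono[OF image_mono[of "{..<j}" "{..<Suc j}" x]] by auto
  obtain s where s: "s \<in> span (x ` {..<j})" "?e = c *\<^sub>R x j - s"
    using c(1) by blast
  have "x j \<in> ?S" by (intro span_base) simp
  then have e: "?e \<in> ?S" using s sub by (simp add: span_diff span_scale)
  show ?case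
  proof (intro exI[of _ "b ?e ?e * c"] conjI allI impI)
    fix w
    obtain t where t: "t \<in> span (x ` {..<j})" "?gs w = c *\<^sub>R w - t"
      using c(1) by blast
    have "b ?e ?e *\<^sub>R t + b (?gs w) ?e *\<^sub>R ?e \<in> ?S"
      using e t sub by (simp add: span_add span_scale)
    moreover have "gram_schmidt b x (Suc j) w =
        (b ?e ?e * c) *\<^sub>R w - (b ?e ?e *\<^sub>R t + b (?gs w) ?e *\<^sub>R ?e)"
      by (simp only: gram_schmidt.simps, subst t(2)) (simp add: algebra_simps)
    ultimately show "\<exists>s\<in>?S. gram_schmidt b x (Suc j) w = (b ?e ?e * c) *\<^sub>R w - s" by blast
  next
    fix w assume "b ?e ?e * c = 0"
    then have "?e = 0 \<or> ?gs w = 0" using c(2) eq_0 by auto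
    then show "gram_schmidt b x (Suc j) w = 0" by (auto simp: simps)
  next
    assume i: "\<forall>i<Suc j. x i \<notin> span (x ` {..<i})"
    then have "c > 0" using c(3) by simp
    have "?e \<noteq> 0"
    proof
      assume "?e = 0"
      then have "c *\<^sub>R x j = s" using s(2) by simp
      then have "x j = (1 / c) *\<^sub>R s" using \<open>c > 0\<close> by auto
      then show False using s(1) i by (metis span_scale lessI)
    qed
    then show "b ?e ?e * c > 0" using pos \<open>c > 0\<close> by simp
  qed
qed

text \<open>Each stage produces a vector orthogonal to \<open>?e\<close> and keeps the orthogonality
  to the earlier \<open>x i\<close>. As \<open>c *\<^sub>R x j\<close> is \<open>?e\<close> plus an
  element of the span of the earlier vectors, orthogonality to \<open>x j\<close> follows if
  \<open>c\<close> is nonzero; if \<open>c = 0\<close> the map is zero anyway.\<close>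

lemma gram_schmidt_orthogonal_gen:
  "i < j \<Longrightarrow> b (gram_schmidt b x j w) (x i) = 0"
proof (induction j arbitrary: i w)
  case (Suc j)
  let ?gs = "gram_schmidt b x j"
  let ?e = "?gs (x j)"
  show ?case
  proof (cases "i = j")
    case False
    then show ?thesis using Suc by (simp add: simps)
  next
    case True
    obtain c where c: "\<And>w. \<exists>s\<in>span (x ` {..<j}). ?gs w = c *\<^sub>R w - s" "c = 0 \<Longrightarrow> ?gs w = 0" for w
      using gram_schmidt_form[of x j] by metis
    show ?thesis
    proof (cases "c = 0")
      case True
      then show ?thesis using c(2) by (simp add: simps)
    next
      case False
      obtain s where s: "s \<in> span (x ` {..<j})" "?e = c *\<^sub>R x j - s" using c(1) by blast
      let ?w = "gram_schmidt b x (Suc j) w"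
      have 1: "b ?w ?e = 0" by (simp add: simps)
      have 2: "b ?w s = 0"
        by (rule orthogonal_span[OF _ s(1)]) (use Suc.IH in \<open>auto simp: simps\<close>)
      have "c *\<^sub>R x j = ?e + s" using s by simp
      then have "b ?w (c *\<^sub>R x j) = 0" by (simp only: simps(2) 1 2 add_0)
      then have "b ?w (x j) = 0" using False by (simp del: gram_schmidt.simps add: simps(6))
      then show ?thesis by (simp only: \<open>i = j\<close>)
    qed
  qed
qed simp

lemma gram_schmidt_orthogonal:
  "u \<in> span (x ` {..<j}) \<Longrightarrow> b (gram_schmidt b x j w) u = 0"
  by (rule orthogonal_span) (auto simp: gram_schmidt_orthogonal_gen)

lemma independent_not_in_span:
  fixes x :: "nat \<Rightarrow> 'v"
  assumes "inj_on x {..<k}" "independent (x ` {..<k})" "i < k"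
  shows "x i \<notin> span (x ` {..<i})"
proof -
  have "x ` {..<i} \<subseteq> x ` {..<k} - {x i}"
    using assms by (auto simp: inj_on_def)
  then have "span (x ` {..<i}) \<subseteq> span (x ` {..<k} - {x i})" by (rule span_mono)
  moreover have "x i \<notin> span (x ` {..<k} - {x i})"
    using assms(2,3) unfolding dependent_def by blast
  ultimately show ?thesis by blast
qed

text \<open>Gram-Schmidt along an enumerated basis of \<open>S\<close> turns \<open>v\<close> into
  \<open>c *\<^sub>R v - s\<close>, orthogonal to \<open>S\<close>, with \<open>c > 0\<close> and
  \<open>s\<close> in \<open>S\<close>; the projection is \<open>s\<close> divided by
  \<open>c\<close>.\<close>

lemma orth_proj_exists:
  assumes "subspace S"
  shows "\<exists>u\<in>S. \<forall>w\<in>S. b (v - u) w = 0"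
proof -
  obtain T where T: "T \<subseteq> S" "independent T" "S \<subseteq> span T" "finite T"
    by (meson basis_exists independent_imp_finite)
  then have ST: "span T = S" using assms span_minimal by blast
  obtain x where x: "bij_betw x {..<card T} T"
    using T(4) ex_bij_betw_nat_finite by (metis atLeast0LessThan)
  then have im: "x ` {..<card T} = T" by (simp add: bij_betw_def)
  have i: "\<forall>i<card T. x i \<notin> span (x ` {..<i})"
    using independent_not_in_span[of x "card T"] T(2) x im by (auto simp: bij_betw_def)
  obtain c s where c: "c > 0" "s \<in> S" "gram_schmidt b x (card T) v = c *\<^sub>R v - s"
    using gram_schmidt_form[of x "card T"] i im ST by metis
  have "b (v - (1 / c) *\<^sub>R s) w = 0" if "w \<in> S" for w
  proof -
    have "v - (1 / c) *\<^sub>R s = (1 / c) *\<^sub>R gram_schmidt b x (card T) v"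
      using c(1) by (simp add: c(3) scaleR_diff_right)
    moreover have "b (gram_schmidt b x (card T) v) w = 0"
      by (rule gram_schmidt_orthogonal) (use that im ST in simp)
    ultimately show ?thesis by (simp add: simps)
  qed
  then show ?thesis using c assms by (meson subspace_scale)
qed

lemma orth_proj_eq:
  assumes "subspace S" "u \<in> S" "\<And>w. w \<in> S \<Longrightarrow> b (v - u) w = 0"
  shows "orth_proj b S v = u"
  unfolding orth_proj_def
proof (rule the_equality)
  fix u' assume u': "u' \<in> S \<and> (\<forall>w\<in>S. b (v - u') w = 0)"
  then have "u' - u \<in> S" using assms by (simp add: subspace_diff)
  then have "b (v - u) (u' - u) = 0" "b (v - u') (u' - u) = 0" using assms u' by auto
  then have "b (u' - u) (u' - u) = 0" by (simp add: simps)
  then show "u' = u" using eq_0 by fastforce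
qed (use assms in auto)

lemma orth_proj_in: "subspace S \<Longrightarrow> orth_proj b S v \<in> S"
  and orth_proj_orthogonal: "subspace S \<Longrightarrow> w \<in> S \<Longrightarrow> b (v - orth_proj b S v) w = 0"
  using orth_proj_exists[of S v] orth_proj_eq[of S _ v] by metis+

lemma orth_proj_complement:
  assumes "subspace S"
  shows "orth_proj b {v. \<forall>u\<in>S. b v u = 0} v = v - orth_proj b S v"
  by (rule orth_proj_eq[OF subspace_orthogonal])
    (use assms orth_proj_orthogonal orth_proj_in commute in auto)

end

section \<open>Global frames, sections and orthogonal fields on a Riemannian manifold\<close>

locale riemannian_manifold = smooth_manifold A
  for A :: "('a::{t2_space, second_countable_topology}, 'e::euclidean_space) chart set" +
  fixes g :: "'a \<Rightarrow> 'e \<Rightarrow> 'e \<Rightarrow> real"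
  assumes metric: "riemannian_metric A g"
begin

sublocale inner: inner_form "g p" for p
  using metric by unfold_locales (auto simp: riemannian_metric_def)

lemma smooth_metric:
  "smooth_field A X \<Longrightarrow> smooth_field A Y \<Longrightarrow> smooth_fun A (\<lambda>p. g p (X p) (Y p))"
  using metric by (simp add: riemannian_metric_def)

lemma smooth_field_gram_schmidt:
  assumes "\<And>i. i < j \<Longrightarrow> smooth_field A (X i)"
  shows "smooth_field A W \<Longrightarrow> smooth_field A (\<lambda>p. gram_schmidt (g p) (\<lambda>i. X i p) j (W p))"
  using assms
proof (induction j arbitrary: W)
  case (Suc j)
  have 1: "smooth_field A (\<lambda>p. gram_schmidt (g p) (\<lambda>i. X i p) j (W p))"
    and 2: "smooth_field A (\<lambda>p. gram_schmidt (g p) (\<lambda>i. X i p) j (X j p))"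
    by (rule Suc.IH; use Suc.prems in simp)+
  show ?case
    unfolding gram_schmidt.simps
    by (intro smooth_field_diff smooth_field_on_scaleR[OF open_UNIV] smooth_metric 1 2)
qed simp

text \<open>A local frame is multiplied by a cutoff \<open>f\<close>. Where \<open>f\<close> is
  nonzero the spans do not change, and where it is zero all fields vanish, so the global fields take
  values in \<open>D\<close> everywhere. Independence at \<open>p\<close> is phrased in the form
  that \<open>gram_schmidt_form\<close> expects.\<close>

lemma distribution_frame:
  assumes "distribution A D"
  obtains X and k :: nat and f where "smooth_fun A f" "f p > 0" "\<And>i. i < k \<Longrightarrow> smooth_field A (X i)"
    "\<And>q. f q \<noteq> 0 \<Longrightarrow> span ((\<lambda>i. X i q) ` {..<k}) = D q"
    "\<And>i. i < k \<Longrightarrow> X i p \<notin> span ((\<lambda>i. X i p) ` {..<i})"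
    "\<And>i q. f q = 0 \<Longrightarrow> X i q = 0"
proof -
  from assms obtain k :: nat where "\<forall>p. \<exists>S X. open S \<and> p \<in> S \<and> (\<forall>i<k. smooth_field_on A S (X i)) \<and>
     (\<forall>q\<in>S. inj_on (\<lambda>i. X i q) {..<k} \<and> independent ((\<lambda>i. X i q) ` {..<k}) \<and>
        span ((\<lambda>i. X i q) ` {..<k}) = D q)"
    unfolding distribution_def by (elim exE)
  from this[rule_format, of p] obtain S X where
    "open S \<and> p \<in> S \<and> (\<forall>i<k. smooth_field_on A S (X i)) \<and>
     (\<forall>q\<in>S. inj_on (\<lambda>i. X i q) {..<k} \<and> independent ((\<lambda>i. X i q) ` {..<k}) \<and>
        span ((\<lambda>i. X i q) ` {..<k}) = D q)"
    by (elim exE)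
  then have S: "open S" "p \<in> S" "i < k \<Longrightarrow> smooth_field_on A S (X i)"
    and X: "q \<in> S \<Longrightarrow> inj_on (\<lambda>i. X i q) {..<k} \<and> independent ((\<lambda>i. X i q) ` {..<k}) \<and>
        span ((\<lambda>i. X i q) ` {..<k}) = D q" for i q
    by simp_all
  obtain f K where f: "smooth_fun A f" "f p > 0" and K: "closed K" "K \<subseteq> S" "\<And>q. q \<notin> K \<Longrightarrow> f q = 0"
    using cutoff_exists[OF S(1,2)] by blast
  have sp: "span ((\<lambda>i. f q *\<^sub>R X i q) ` {..<j}) = span ((\<lambda>i. X i q) ` {..<j})" if "f q \<noteq> 0" for q j
    using span_image_scale[of "(\<lambda>i. X i q) ` {..<j}" "\<lambda>_. f q"] that by (simp add: image_image)
  show thesis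
  proof (rule that[OF f])
    show "smooth_field A (\<lambda>q. f q *\<^sub>R X i q)" if "i < k" for i
      by (rule smooth_field_cutoff[OF S(1) S(3)[OF that] f(1) K])
    show "span ((\<lambda>i. f q *\<^sub>R X i q) ` {..<k}) = D q" if "f q \<noteq> 0" for q
      using sp[OF that] X[of q] K that by blast
    show "f p *\<^sub>R X i p \<notin> span ((\<lambda>i. f p *\<^sub>R X i p) ` {..<i})" if "i < k" for i
    proof
      assume "f p *\<^sub>R X i p \<in> span ((\<lambda>i. f p *\<^sub>R X i p) ` {..<i})"
      then have "(1 / f p) *\<^sub>R f p *\<^sub>R X i p \<in> span ((\<lambda>i. X i p) ` {..<i})"
        using sp[of p i] f(2) by (simp only: span_scale)
      then show False
        using inner.independent_not_in_span[of "\<lambda>i. X i p" k i] X[OF S(2)] that f(2) by auto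
    qed
  qed auto
qed

lemma distribution_subspace: "distribution A D \<Longrightarrow> subspace (D p)"
  using distribution_frame[of D p] by (metis less_irrefl subspace_span)

text \<open>The values at \<open>p\<close> of global sections form a subspace \<open>?E\<close> that
  contains the cut-off frame at \<open>p\<close>, and this frame spans \<open>D p\<close>.\<close>

lemma section_through:
  assumes "distribution A D" "v \<in> D p"
  obtains Y where "Y \<in> sections A D" "Y p = v"
proof -
  obtain X and k :: nat and f where X: "smooth_fun A f" "f p > 0" "\<And>i. i < k \<Longrightarrow> smooth_field A (X i)"
    "\<And>q. f q \<noteq> 0 \<Longrightarrow> span ((\<lambda>i. X i q) ` {..<k}) = D q"
    "\<And>i q. f q = 0 \<Longrightarrow> X i q = 0"
    using distribution_frame[OF assms(1), of p] by metis
  note sub = distribution_subspace[OF assms(1)]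
  let ?E = "{v. \<exists>Y\<in>sections A D. Y p = v}"
  have "X i \<in> sections A D" if "i < k" for i
  proof -
    have "X i q \<in> D q" for q
    proof (cases "f q = 0")
      case True
      then show ?thesis using X(5) sub by (simp add: subspace_0)
    next
      case False
      then show ?thesis using X(4)[OF False] that by (metis imageI lessThan_iff span_base)
    qed
    then show ?thesis using X(3) that by (simp add: sections_def)
  qed
  then have "(\<lambda>i. X i p) ` {..<k} \<subseteq> ?E" by auto
  moreover have "subspace ?E"
  proof (unfold subspace_def, safe)
    have "(\<lambda>p. 0) \<in> sections A D" using sub by (simp add: sections_def smooth_field_0 subspace_0)
    then show "\<exists>Y\<in>sections A D. Y p = 0" by fastforce
  next
    fix Y Z assume "Y \<in> sections A D" "Z \<in> sections A D"
    then have "(\<lambda>p. Y p + Z p) \<in> sections A D"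
      using sub by (simp add: sections_def smooth_field_on_add[OF open_UNIV] subspace_add)
    then show "\<exists>W\<in>sections A D. W p = Y p + Z p" by fastforce
  next
    fix Y and c :: real assume "Y \<in> sections A D"
    then have "(\<lambda>p. c *\<^sub>R Y p) \<in> sections A D"
      using sub by (simp add: sections_def smooth_field_on_scaleR[OF open_UNIV smooth_fun_const] subspace_scale)
    then show "\<exists>W\<in>sections A D. W p = c *\<^sub>R Y p" by fastforce
  qed
  ultimately have "span ((\<lambda>i. X i p) ` {..<k}) \<subseteq> ?E" by (rule span_minimal)
  then show thesis using that assms(2) X(2) X(4)[of p] by auto
qed

text \<open>Replaces the horizontal part of \<open>N\<close>, up to a nonzero factor at
  \<open>p\<close>: its smoothness is visible from the Gram-Schmidt formula, while
  \<open>orth_proj\<close> is a pointwise description. \<open>N\<close> is orthogonalised first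
  against a frame of \<open>D1\<close>, then against one of \<open>D2\<close>.\<close>

lemma orthogonal_field_exists:
  assumes D: "distribution A D1" "distribution A D2"
    and orth: "\<And>q u v. u \<in> D1 q \<Longrightarrow> v \<in> D2 q \<Longrightarrow> g q u v = 0"
    and N: "smooth_field A N"
  obtains Y c s1 s2 where "smooth_field A Y" "\<And>q u. u \<in> D1 q \<union> D2 q \<Longrightarrow> g q (Y q) u = 0"
    "c \<noteq> 0" "s1 \<in> D1 p" "s2 \<in> D2 p" "Y p = c *\<^sub>R N p - (s1 + s2)"
proof -
  obtain X1 and k1 :: nat and f1 where X1: "smooth_fun A f1" "f1 p > 0" "\<And>i. i < k1 \<Longrightarrow> smooth_field A (X1 i)"
    "\<And>q. f1 q \<noteq> 0 \<Longrightarrow> span ((\<lambda>i. X1 i q) ` {..<k1}) = D1 q"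
    "\<And>i. i < k1 \<Longrightarrow> X1 i p \<notin> span ((\<lambda>i. X1 i p) ` {..<i})"
    using distribution_frame[OF D(1), of p] by metis
  obtain X2 and k2 :: nat and f2 where X2: "smooth_fun A f2" "f2 p > 0" "\<And>i. i < k2 \<Longrightarrow> smooth_field A (X2 i)"
    "\<And>q. f2 q \<noteq> 0 \<Longrightarrow> span ((\<lambda>i. X2 i q) ` {..<k2}) = D2 q"
    "\<And>i. i < k2 \<Longrightarrow> X2 i p \<notin> span ((\<lambda>i. X2 i p) ` {..<i})"
    using distribution_frame[OF D(2), of p] by metis
  define P1 where "P1 q w = gram_schmidt (g q) (\<lambda>i. X1 i q) k1 w" for q w
  define P2 where "P2 q w = gram_schmidt (g q) (\<lambda>i. X2 i q) k2 w" for q w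
  \<comment> \<open>The cutoffs make \<open>Y\<close> vanish wherever one of the two frames may fail
    to span its distribution.\<close>
  define Y where "Y q = (f1 q * f2 q) *\<^sub>R P2 q (P1 q (N q))" for q
  have "smooth_field A Y"
    unfolding Y_def P1_def P2_def
    by (intro smooth_field_on_scaleR[OF open_UNIV] smooth_fun_mult X1 X2 smooth_field_gram_schmidt N)
  moreover have "g q (Y q) u = 0" if u: "u \<in> D1 q \<union> D2 q" for q u
  proof (cases "f1 q * f2 q = 0")
    case True
    then show ?thesis by (simp add: Y_def inner.simps)
  next
    case False
    then have s: "span ((\<lambda>i. X1 i q) ` {..<k1}) = D1 q" "span ((\<lambda>i. X2 i q) ` {..<k2}) = D2 q"
      using X1(4) X2(4) by auto
    have 1: "g q (P1 q w) u = 0" if "u \<in> D1 q" for w u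
      unfolding P1_def by (rule inner.gram_schmidt_orthogonal) (use s that in simp)
    have 2: "g q (P2 q w) u = 0" if "u \<in> D2 q" for w u
      unfolding P2_def by (rule inner.gram_schmidt_orthogonal) (use s that in simp)
    obtain c t where "t \<in> D2 q" "P2 q (P1 q (N q)) = c *\<^sub>R P1 q (N q) - t"
      using inner.gram_schmidt_form[where x = "\<lambda>i. X2 i q" and j = k2 and p = q] s P2_def by metis
    \<comment> \<open>The second orthogonalisation rescales and subtracts a vector of
      \<open>D2\<close>, which is orthogonal to \<open>D1\<close>, so orthogonality to
      \<open>D1\<close> survives.\<close>
    then have "g q (P2 q (P1 q (N q))) u = 0" if "u \<in> D1 q" for u
      using 1[OF that] orth[OF that] by (simp add: inner.simps inner.commute[of q t])
    then show ?thesis using u 2 by (auto simp: Y_def inner.simps)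
  qed
  moreover obtain c1 t1 where t1: "c1 > 0" "t1 \<in> D1 p" "P1 p (N p) = c1 *\<^sub>R N p - t1"
    using inner.gram_schmidt_form[where x = "\<lambda>i. X1 i p" and j = k1 and p = p] X1(2,5) X1(4)[of p]
    unfolding P1_def by (metis less_irrefl)
  moreover obtain c2 t2 where t2: "c2 > 0" "t2 \<in> D2 p" "P2 p (P1 p (N p)) = c2 *\<^sub>R P1 p (N p) - t2"
    using inner.gram_schmidt_form[where x = "\<lambda>i. X2 i p" and j = k2 and p = p] X2(2,5) X2(4)[of p]
    unfolding P2_def by (metis less_irrefl)
  moreover have "Y p = (f1 p * f2 p * c2 * c1) *\<^sub>R N p -
      ((f1 p * f2 p * c2) *\<^sub>R t1 + (f1 p * f2 p) *\<^sub>R t2)"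
    by (simp only: Y_def t2(3), simp only: t1(3)) (simp add: algebra_simps)
  ultimately show thesis
    using X1(2) X2(2) D[THEN distribution_subspace, THEN subspace_scale]
    by (intro that[of Y "f1 p * f2 p * c2 * c1" "(f1 p * f2 p * c2) *\<^sub>R t1" "(f1 p * f2 p) *\<^sub>R t2"])
      auto
qed

end

subsection \<open>Bi-slant submersions\<close>

locale bi_slant =
  fixes A :: "('a::{t2_space, second_countable_topology}, 'e::euclidean_space) chart set"
    and phi xi eta g nabla
    and B :: "('b::{t2_space, second_countable_topology}, 'f::euclidean_space) chart set"
    and g' F D1 D2 \<theta>1 \<theta>2
  assumes bi_slant: "bi_slant_submersion A phi xi eta g nabla B g' F D1 D2 \<theta>1 \<theta>2"
begin

sublocale riemannian_manifold A g
  using bi_slant by unfold_locales (auto simp: bi_slant_submersion_def)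

sublocale base: smooth_manifold B
  using bi_slant by unfold_locales (auto simp: bi_slant_submersion_def)

abbreviation "ver \<equiv> vert A B F"
abbreviation "hor \<equiv> horiz A B g F"
abbreviation "V \<equiv> vert_part A B g F"
abbreviation "H \<equiv> horiz_part A B g F"

lemma levi_civita: "levi_civita A g nabla"
  and smooth_map: "smooth_map A B F"
  and xi_horizontal: "xi p \<in> hor p"
  and distributions: "distribution A D1" "distribution A D2"
  and vert_eq: "ver p = {u + v |u v. u \<in> D1 p \<and> v \<in> D2 p}"
  and D_orthogonal: "u \<in> D1 p \<Longrightarrow> v \<in> D2 p \<Longrightarrow> g p u v = 0"
  using bi_slant by (auto simp: bi_slant_submersion_def riemannian_submersion_def)

lemma
  shows smooth_xi: "smooth_field A xi"
    and linear_phi: "linear (phi p)"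
    and eta_xi: "eta p (xi p) = 1"
    and eta_phi: "eta p (phi p v) = 0"
    and phi_xi: "phi p (xi p) = 0"
    and metric_phi: "g p (phi p u) (phi p v) = g p u v - eta p u * eta p v"
    and contact: "contact_metric A phi eta g"
    and nabla_phi: "smooth_field A X \<Longrightarrow> smooth_field A Y \<Longrightarrow> nabla X (\<lambda>q. phi q (Y q)) p =
      phi p (nabla X Y p) + (g p (X p) (Y p) *\<^sub>R xi p - eta p (Y p) *\<^sub>R X p)"
    and nabla_xi: "smooth_field A X \<Longrightarrow> nabla X xi p = - phi p (X p)"
  using bi_slant
  by (auto simp: bi_slant_submersion_def sasakian_def almost_contact_metric_def diff_eq_eq add.commute)

lemma
  shows smooth_nabla: "smooth_field A X \<Longrightarrow> smooth_field A Y \<Longrightarrow> smooth_field A (nabla X Y)"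
    and nabla_scale: "smooth_fun A f \<Longrightarrow> smooth_field A X \<Longrightarrow> smooth_field A Y \<Longrightarrow>
      nabla X (\<lambda>p. f p *\<^sub>R Y p) = (\<lambda>p. deriv_along A X f p *\<^sub>R Y p + f p *\<^sub>R nabla X Y p)"
    and lie_bracket_nabla: "smooth_field A X \<Longrightarrow> smooth_field A Y \<Longrightarrow>
      is_lie_bracket A X Y (\<lambda>p. nabla X Y p - nabla Y X p)"
    and nabla_metric: "smooth_field A X \<Longrightarrow> smooth_field A Y \<Longrightarrow> smooth_field A Z \<Longrightarrow>
      deriv_along A X (\<lambda>q. g q (Y q) (Z q)) p = g p (nabla X Y p) (Z p) + g p (Y p) (nabla X Z p)"
  using levi_civita by (auto simp: levi_civita_def)

lemma nabla_0: "smooth_field A X \<Longrightarrow> nabla X (\<lambda>p. 0) = (\<lambda>p. 0)"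
  using nabla_scale[OF smooth_fun_const[of 0] _ smooth_field_0, of X]
  by (simp add: deriv_along_const)

section \<open>Vertical and horizontal parts\<close>

lemma subspace_vert: "subspace (ver p)"
  using subspace_sums[OF distribution_subspace distribution_subspace, OF distributions]
  by (simp add: vert_eq)

lemma D_vert: "u \<in> D1 p \<Longrightarrow> u \<in> ver p" "u \<in> D2 p \<Longrightarrow> u \<in> ver p"
  using distributions[THEN distribution_subspace, THEN subspace_0, of p]
  by (force simp: vert_eq)+

lemma horiz_part_eq: "H X p = X p - V X p"
  by (simp add: horiz_part_def vert_part_def horiz_def inner.orth_proj_complement subspace_vert)

lemma vert_part_vert: "X p \<in> ver p \<Longrightarrow> V X p = X p"
  by (simp add: vert_part_def inner.orth_proj_eq subspace_vert inner.simps)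

lemma vert_part_horiz: "X p \<in> hor p \<Longrightarrow> V X p = 0"
  using subspace_0[OF subspace_vert]
  by (simp add: vert_part_def inner.orth_proj_eq subspace_vert horiz_def)

lemma vert_part_in: "V X p \<in> ver p"
  by (simp add: vert_part_def inner.orth_proj_in subspace_vert)

lemma horiz_part_in: "H X p \<in> hor p"
  by (auto simp: horiz_part_eq vert_part_def horiz_def inner.orth_proj_orthogonal subspace_vert)

lemma horiz_vert: "u \<in> hor p \<Longrightarrow> v \<in> ver p \<Longrightarrow> g p u v = 0" "v \<in> ver p \<Longrightarrow> u \<in> hor p \<Longrightarrow> g p v u = 0"
  by (simp_all add: horiz_def inner.commute[of p v])

lemma metric_split: "g p (X p) (Y p) = g p (V X p) (V Y p) + g p (H X p) (H Y p)"
proof -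
  have "g p (V X p + H X p) (V Y p + H Y p) = g p (V X p) (V Y p) + g p (H X p) (H Y p)"
    using vert_part_in horiz_part_in horiz_vert by (simp add: inner.simps(1,2))
  then show ?thesis by (simp add: horiz_part_eq)
qed

text \<open>In the compatibility of the metric with \<phi>, put \<xi> in the second slot: the left
  side vanishes as \<phi> kills \<xi>, and \<eta>(\<xi>) = 1.\<close>

lemma eta_eq: "eta p v = g p v (xi p)"
  using metric_phi[of p v "xi p"] by (simp add: phi_xi eta_xi inner.simps)

lemma eta_vert: "v \<in> ver p \<Longrightarrow> eta p v = 0"
  using xi_horizontal horiz_vert by (simp add: eta_eq)

section \<open>Integrability of the vertical distribution and anti-invariance\<close>

lemma deriv_along_vertical:
  assumes "smooth_fun B h" "\<And>p. X p \<in> ver p"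
  shows "deriv_along A X (h \<circ> F) = (\<lambda>p. 0)"
proof
  fix p
  have "differential A B F p (X p) = 0" using assms(2) by (simp add: vert_def)
  then show "deriv_along A X (h \<circ> F) p = 0"
    using smooth_map_comp(2)[OF base.smooth_manifold_axioms smooth_map assms(1), of p "X p"]
      linear_0[OF base.linear_deriv[OF assms(1)]]
    by (simp add: deriv_along_def)
qed

text \<open>Vertical fields annihilate every function pulled back from the base, hence so does their
  commutator. With a function \<open>h\<close> whose derivative along \<open>?v\<close> is
  \<open>?v \<bullet> ?v\<close>, this forces the image of \<open>L p\<close> under the differential
  to vanish.\<close>

lemma lie_bracket_vertical:
  assumes "is_lie_bracket A X Y L" "\<And>p. X p \<in> ver p" "\<And>p. Y p \<in> ver p"
  shows "L p \<in> ver p"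
proof -
  let ?v = "differential A B F p (L p)"
  obtain h where h: "smooth_fun B h" "frechet_derivative (h \<circ> chart_inv (chart_at B (F p)))
      (at (snd (chart_at B (F p)) (F p))) ?v = ?v \<bullet> ?v"
    using base.smooth_fun_with_derivative[of "F p" ?v] by blast
  have s: "smooth_fun A (h \<circ> F)"
    by (rule smooth_map_comp(1)[OF base.smooth_manifold_axioms smooth_map h(1)])
  have "deriv_along A L (h \<circ> F) p = 0"
    using assms(1) s
    by (simp add: is_lie_bracket_def deriv_along_vertical[OF h(1)] assms(2,3) deriv_along_const)
  then have "?v \<bullet> ?v = 0"
    using smooth_map_comp(2)[OF base.smooth_manifold_axioms smooth_map h(1), of p "L p"] h(2)
    by (simp add: deriv_along_def)
  then show ?thesis by (simp add: vert_def)
qed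

lemma vertical_section_through:
  assumes "v \<in> ver p"
  obtains X where "smooth_field A X" "\<And>p. X p \<in> ver p" "X p = v"
proof -
  obtain v1 v2 where v: "v1 \<in> D1 p" "v2 \<in> D2 p" "v = v1 + v2"
    using assms by (auto simp: vert_eq)
  obtain X1 where "X1 \<in> sections A D1" "X1 p = v1"
    using section_through[OF distributions(1) v(1)] by blast
  moreover obtain X2 where "X2 \<in> sections A D2" "X2 p = v2"
    using section_through[OF distributions(2) v(2)] by blast
  ultimately show thesis
    using v by (intro that[of "\<lambda>p. X1 p + X2 p"])
      (auto simp: sections_def vert_eq intro: smooth_field_on_add[OF open_UNIV])
qed

text \<open>The contact condition speaks of fields, so both vectors are extended to global vertical
  fields. Then all three terms of d\<eta> vanish: \<eta> is zero on both fields and on their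
  bracket.\<close>

lemma anti_invariant:
  assumes "u \<in> ver p" "v \<in> ver p"
  shows "g p u (phi p v) = 0"
proof -
  obtain X where X: "smooth_field A X" "\<And>p. X p \<in> ver p" "X p = u"
    using vertical_section_through[OF assms(1)] by blast
  obtain Y where Y: "smooth_field A Y" "\<And>p. Y p \<in> ver p" "Y p = v"
    using vertical_section_through[OF assms(2)] by blast
  let ?L = "\<lambda>p. nabla X Y p - nabla Y X p"
  \<comment> \<open>Torsion-freeness of the connection provides a bracket to which
    \<open>contact_metric\<close> can be applied.\<close>
  have L: "is_lie_bracket A X Y ?L" by (rule lie_bracket_nabla[OF X(1) Y(1)])
  have "eta p (?L p) = 0"
    using lie_bracket_vertical[OF L X(2) Y(2)] by (rule eta_vert)
  moreover have "(deriv_along A X (\<lambda>q. eta q (Y q)) p - deriv_along A Y (\<lambda>q. eta q (X q)) p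
      - eta p (?L p)) / 2 = g p (X p) (phi p (Y p))"
    using contact X(1) Y(1) L unfolding contact_metric_def by blast
  ultimately show ?thesis
    using X Y by (simp add: eta_vert deriv_along_const)
qed

section \<open>The two conditions as orthogonality relations\<close>

lemma phi_horizontal: "v \<in> ver p \<Longrightarrow> phi p v \<in> hor p"
  using anti_invariant by (simp add: horiz_def inner.commute[of p "phi p v"])

text \<open>Since \<eta>(Z) = 0, the derivative of \<phi>Z along W differs from \<phi> of the
  derivative of Z by a multiple of \<xi>, which is orthogonal to the image of \<phi>. Compatibility
  of the metric then removes \<phi> from both slots, because the derivative of Z has no
  \<xi>-component. The vector \<open>y\<close> stays arbitrary so that it can be taken in
  \<open>D1\<close> or horizontal.\<close>

lemma nabla_phi_vertical:
  assumes "smooth_field A W" "\<And>p. W p \<in> ver p" "smooth_field A Z" "\<And>p. Z p \<in> ver p"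
  shows "g p (nabla W (\<lambda>q. phi q (Z q)) p) (phi p y) = g p (nabla W Z p) y"
proof -
  \<comment> \<open>Differentiating g(Z, \<xi>) = 0 along W, with the derivative of \<xi> equal to
    -\<phi>W, expresses \<eta> of the derivative of Z as g(Z, \<phi>W), which is zero by
    anti-invariance.\<close>
  have "deriv_along A W (\<lambda>q. g q (Z q) (xi q)) p = 0"
    using eta_vert[OF assms(4)] by (simp add: eta_eq deriv_along_const)
  then have "eta p (nabla W Z p) = g p (Z p) (phi p (W p))"
    using nabla_metric[OF assms(1,3) smooth_xi, of p] nabla_xi[OF assms(1)]
    by (simp add: eta_eq inner.simps)
  then have "eta p (nabla W Z p) = 0" using anti_invariant assms by simp
  moreover have "g p (xi p) (phi p y) = 0"
    using eta_phi by (simp add: eta_eq inner.commute[of p "xi p"])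
  ultimately show ?thesis
    using assms by (simp add: nabla_phi eta_vert inner.simps metric_phi)
qed

text \<open>\<open>vphi\<close> and \<open>omega\<close> also serve as the operators B and C, all
  being vertical or horizontal parts of \<phi>. The terms that contain \<open>vphi Z\<close> vanish,
  and what remains of either condition says that one and the same sum, given by
  \<open>split\<close>, is zero.\<close>

lemma condition_iff:
  assumes W: "smooth_field A W" "\<And>p. W p \<in> ver p" and Z: "smooth_field A Z" "\<And>p. Z p \<in> ver p"
  defines "T \<equiv> oneill_T A B g nabla F"
    and "vphi \<equiv> \<lambda>U. V (\<lambda>p. phi p (U p))" and "omega \<equiv> \<lambda>U. H (\<lambda>p. phi p (U p))"
  shows "- g p (T W (omega (vphi Z)) p) (U p) =
      g p (T W (omega Z) p) (vphi U p) + g p (H (nabla W (omega Z)) p) (omega U p) \<longleftrightarrow>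
      g p (nabla W Z p) (U p) = 0" (is ?first)
    and "g p (T W (omega Z) p) (vphi X p) =
      g p (H (nabla W (omega (vphi Z))) p) (X p) - g p (H (nabla W (omega Z)) p) (omega X p) \<longleftrightarrow>
      g p (nabla W Z p) (X p) = 0" (is ?second)
proof -
  have vphi: "vphi Y = (\<lambda>p. 0)" and omega: "omega Y = (\<lambda>p. phi p (Y p))"
    if "\<And>p. Y p \<in> ver p" for Y
    using phi_horizontal[OF that]
    by (simp_all add: vphi_def omega_def fun_eq_iff horiz_part_eq vert_part_horiz)
  have V0: "V (\<lambda>p. 0) = (\<lambda>p. 0)"
    using subspace_0[OF subspace_vert] by (simp add: fun_eq_iff vert_part_vert)
  then have H0: "H (\<lambda>p. 0) = (\<lambda>p. 0)" by (simp add: fun_eq_iff horiz_part_eq)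
  have VW: "V W = W" using W(2) by (simp add: fun_eq_iff vert_part_vert)
  have omega0: "omega (\<lambda>p. 0) = (\<lambda>p. 0)"
    by (simp add: omega_def linear_0[OF linear_phi] H0)
  have T0: "T W (\<lambda>p. 0) = (\<lambda>p. 0)"
    by (simp add: T_def oneill_T_def V0 H0 VW nabla_0[OF W(1)])
  \<comment> \<open>\<open>omega Z\<close> is \<phi>Z, a horizontal field, so of the two summands of
    the O'Neill tensor only the vertical part of \<open>?N\<close> is left.\<close>
  let ?N = "nabla W (\<lambda>p. phi p (Z p))"
  have TZ: "T W (omega Z) = V ?N"
    using vphi[OF Z(2)] omega[OF Z(2)]
    by (simp add: T_def oneill_T_def omega_def vphi_def VW V0 H0 nabla_0[OF W(1)])
  \<comment> \<open>Both \<open>?N\<close> and \<phi>Y are split into vertical and horizontal parts;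
    the field \<open>Y\<close> is arbitrary here.\<close>
  have split: "g p (nabla W Z p) (Y p) =
      g p (T W (omega Z) p) (vphi Y p) + g p (H (nabla W (omega Z)) p) (omega Y p)" for Y
    using metric_split[of p ?N "\<lambda>p. phi p (Y p)"] nabla_phi_vertical[OF W Z, of p "Y p"]
    by (simp only: TZ, simp only: omega[OF Z(2)]) (simp only: vphi_def omega_def)
  show ?first
    by (simp add: split vphi[OF Z(2)] omega0 T0 inner.simps eq_commute[of 0])
  show ?second
    unfolding split vphi[OF Z(2)] omega0 nabla_0[OF W(1)] H0 by (auto simp: inner.simps)
qed

text \<open>Testing against a horizontal field \<open>Y\<close> with
  \<open>Y p = c *\<^sub>R N p - (s1 + s2)\<close> gives \<open>g p (Y p) (Y p) = 0\<close>, so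
  \<open>N p\<close> is vertical. Testing against a section of \<open>D1\<close> through
  \<open>s1\<close> then removes the component in \<open>D1\<close>.\<close>

lemma mem_D2:
  assumes "smooth_field A N" "\<And>U. U \<in> sections A D1 \<Longrightarrow> g p (N p) (U p) = 0"
    "\<And>X. X \<in> sections A hor \<Longrightarrow> g p (N p) (X p) = 0"
  shows "N p \<in> D2 p"
proof -
  obtain Y c s1 s2 where Y: "smooth_field A Y" "\<And>q u. u \<in> D1 q \<union> D2 q \<Longrightarrow> g q (Y q) u = 0"
    and s: "c \<noteq> 0" "s1 \<in> D1 p" "s2 \<in> D2 p" "Y p = c *\<^sub>R N p - (s1 + s2)"
    using orthogonal_field_exists[OF distributions D_orthogonal assms(1), of p] by metis
  have "Y q \<in> hor q" for q
    using Y(2) by (auto simp: horiz_def vert_eq inner.simps)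
  then have "g p (N p) (Y p) = 0"
    using assms(3) Y(1) by (simp add: sections_def)
  moreover have "g p s1 (Y p) = 0" "g p s2 (Y p) = 0"
    using Y(2)[of s1 p] Y(2)[of s2 p] s(2,3) inner.commute[of p "Y p"] by simp_all
  ultimately have "g p (c *\<^sub>R N p - (s1 + s2)) (Y p) = 0"
    by (simp add: inner.simps)
  then have "Y p = 0" using inner.eq_0[of p "Y p"] by (simp only: s(4))
  then have N: "c *\<^sub>R N p = s1 + s2" using s(4) by simp
  obtain U where "U \<in> sections A D1" "U p = s1"
    using section_through[OF distributions(1) s(2)] by blast
  then have "g p (N p) s1 = 0" using assms(2) by blast
  then have "g p (c *\<^sub>R N p) s1 = 0" by (simp add: inner.simps)
  then have "g p (s1 + s2) s1 = 0" by (simp only: N)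
  then have "s1 = 0"
    using D_orthogonal[OF s(2,3)] inner.eq_0 by (simp add: inner.simps inner.commute[of p s2])
  then have "N p = (1 / c) *\<^sub>R s2" using N s(1) by auto
  then show ?thesis
    using s(3) distribution_subspace[OF distributions(2)] by (simp add: subspace_scale)
qed

lemma totally_geodesic_iff:
  "totally_geodesic_foliation A nabla D2 \<longleftrightarrow>
    (\<forall>U\<in>sections A D1. \<forall>W\<in>sections A D2. \<forall>Z\<in>sections A D2. \<forall>X\<in>sections A hor. \<forall>p.
      g p (nabla W Z p) (U p) = 0 \<and> g p (nabla W Z p) (X p) = 0)" (is "_ \<longleftrightarrow> ?R")
proof
  assume t: "totally_geodesic_foliation A nabla D2"
  show ?R
  proof (intro ballI allI)
    fix U W Z X p
    assume "U \<in> sections A D1" "W \<in> sections A D2" "Z \<in> sections A D2" "X \<in> sections A hor"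
    moreover from this t have "nabla W Z p \<in> D2 p"
      by (simp add: totally_geodesic_foliation_def sections_def)
    ultimately show "g p (nabla W Z p) (U p) = 0 \<and> g p (nabla W Z p) (X p) = 0"
      using D_orthogonal horiz_vert(2) D_vert(2) by (simp add: sections_def inner.commute[of p _ "U p"])
  qed
next
  assume R: ?R
  have sub: "subspace (hor q)" for q
    by (simp add: horiz_def inner.subspace_orthogonal)
  \<comment> \<open>The assumption quantifies over \<open>U\<close> and \<open>X\<close> jointly;
    the zero sections fill the other slot when one of the two equations is extracted.\<close>
  have 0: "(\<lambda>p. 0) \<in> sections A D1" "(\<lambda>p. 0) \<in> sections A hor"
    using smooth_field_0 distribution_subspace[OF distributions(1)] sub
    by (simp_all add: sections_def subspace_0)
  show "totally_geodesic_foliation A nabla D2"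
    unfolding totally_geodesic_foliation_def
  proof (intro ballI)
    fix W Z assume WZ: "W \<in> sections A D2" "Z \<in> sections A D2"
    then have "smooth_field A (nabla W Z)" by (simp add: sections_def smooth_nabla)
    moreover from this have "nabla W Z p \<in> D2 p" for p
      using R WZ 0 by (intro mem_D2) blast+
    ultimately show "nabla W Z \<in> sections A D2" by (simp add: sections_def)
  qed
qed

end

theorem theorem3p5:
  fixes A :: "('a::{t2_space, second_countable_topology}, 'e::euclidean_space) chart set"
    and phi :: "'a \<Rightarrow> 'e \<Rightarrow> 'e" and xi :: "'a \<Rightarrow> 'e" and eta :: "'a \<Rightarrow> 'e \<Rightarrow> real"
    and g :: "'a \<Rightarrow> 'e \<Rightarrow> 'e \<Rightarrow> real"
    and nabla :: "('a \<Rightarrow> 'e) \<Rightarrow> ('a \<Rightarrow> 'e) \<Rightarrow> ('a \<Rightarrow> 'e)"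
    and B :: "('b::{t2_space, second_countable_topology}, 'f::euclidean_space) chart set"
    and g' :: "'b \<Rightarrow> 'f \<Rightarrow> 'f \<Rightarrow> real"
    and F :: "'a \<Rightarrow> 'b"
    and D1 D2 :: "'a \<Rightarrow> 'e set" and \<theta>1 \<theta>2 :: real
  assumes "bi_slant_submersion A phi xi eta g nabla B g' F D1 D2 \<theta>1 \<theta>2"
  shows "let V = vert_part A B g F;
             H = horiz_part A B g F;
             T = oneill_T A B g nabla F;
             vphi = (\<lambda>U. V (\<lambda>p. phi p (U p)));
             omega = (\<lambda>U. H (\<lambda>p. phi p (U p)));
             Bop = (\<lambda>X. V (\<lambda>p. phi p (X p)));
             Cop = (\<lambda>X. H (\<lambda>p. phi p (X p)))
         in totally_geodesic_foliation A nabla D2 \<longleftrightarrow>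
            (\<forall>U\<in>sections A D1. \<forall>W\<in>sections A D2. \<forall>Z\<in>sections A D2.
               \<forall>X\<in>sections A (horiz A B g F). \<forall>p.
               - g p (T W (omega (vphi Z)) p) (U p) =
                 g p (T W (omega Z) p) (vphi U p) + g p (H (nabla W (omega Z)) p) (omega U p) \<and>
               g p (T W (omega Z) p) (Bop X p) =
                 g p (H (nabla W (omega (vphi Z))) p) (X p) - g p (H (nabla W (omega Z)) p) (Cop X p))"
proof -
  interpret bi_slant A phi xi eta g nabla B g' F D1 D2 \<theta>1 \<theta>2
    using assms by unfold_locales
  have v: "smooth_field A W \<and> (\<forall>p. W p \<in> ver p)" if "W \<in> sections A D1 \<or> W \<in> sections A D2" for W
    using that D_vert by (auto simp: sections_def)
  show ?thesis
    \<comment> \<open>Both sides now range over the same fields and points, so the equivalence is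
      proved instance by instance; after unfolding, \<open>Bop\<close> and \<open>Cop\<close>
      coincide with \<open>vphi\<close> and \<open>omega\<close>.\<close>
    unfolding Let_def totally_geodesic_iff
    by (intro ball_cong refl arg_cong[where f = All] ext) (simp add: condition_iff v)
qed

end
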